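(* Let $(X,\mathbb{A},\mu)$ be a measure space, let $\tau:X\to X$ be an injective non-singular measurable transformation, let $\varphi$ be an Orlicz function satisfying the $\Delta_2$-condition and $h$ a weight function, and let $C_\tau g=g\circ\tau$ be the (continuous) composition operator on the Orlicz-Lorentz space $\mathbb{L}^{\varphi,h}(\mu)$. Then the following are equivalent: (a) $C_\tau$ on $\mathbb{L}^{\varphi,h}(\mu)$ is Li-Yorke chaotic. (b) There exists a measurable function $0\ne g\in\mathbb{L}^{\varphi,h}(\mu)$ such that $\displaystyle\liminf_{n\to\infty}\|C_\tau^n g\|_{\varphi,h}=0$. (c) There exists $A\in\mathbb{A}$ with $0<\mu(A)<\infty$ such that $\displaystyle\limsup_{n\to\infty}\varphi^{-1}\left(\frac{1}{\int_0^{\mu(\tau^{-n}(A))}h(t)\,dt}\right)=\infty$. (d) There exists $A\in\mathbb{A}$ with $0<\mu(A)<\infty$ such that $\displaystyle\limsup_{n\to\infty}\varphi^{-1}\left(\frac{1}{\int_0^{\mu(\tau^{n}(A))}h(t)\,dt}\right)=\infty$. (e) There exists $A\in\mathbb{A}$ with $0<\mu(A)<\infty$ such that $\displaystyle\limsup_{n\to\infty}\varphi^{-1}\left(\frac{1}{\int_0^{\mu(\tau^{-n}(A))}h(t)\,dt}\right)=\infty$ and $\displaystyle\limsup_{n\to\infty}\varphi^{-1}\left(\frac{1}{\int_0^{\mu(\tau^{n}(A))}h(t)\,dt}\right)=\infty$. (f) There exists $A\in\mathbb{A}$ with $0<\mu(A)<\infty$ such that $\displaystyle\liminf_{n\to\infty}\varphi^{-1}\left(\frac{1}{\int_0^{\mu(\tau^{-n}(A))}h(t)\,dt}\right)>0$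 and $\displaystyle\limsup_{n\to\infty}\varphi^{-1}\left(\frac{1}{\int_0^{\mu(\tau^{-n}(A))}h(t)\,dt}\right)=\infty$. (g) There is a measurable set $A$ such that the characteristic function $\chi_A$ is a semi-irregular vector for $C_\tau$ on $\mathbb{L}^{\varphi,h}(\mu)$.
   Context: $(X,\mathbb{A},\mu)$ is a measure space with positive measure and $\mathbb{L}^0$ is the space of ($\mu$-a.e. equivalence classes of) measurable functions on $X$. A measurable $\tau:X\to X$ is non-singular if $\mu(\tau^{-1}(A))=0$ whenever $A\in\mathbb{A}$ and $\mu(A)=0$; then $C_\tau g=g\circ\tau$ is well defined. For $n\ge 1$, $\tau^{n}(A)$ is the image and $\tau^{-n}(A)$ the preimage of $A$ under the $n$-fold iterate of $\tau$. For $g\in\mathbb{L}^0$, $\mu_g(\lambda)=\mu\{x\in X:|g(x)|>\lambda\}$ and the non-increasing rearrangement is $g^*(t)=\inf\{\lambda>0:\mu_g(\lambda)\le t\}$ for $t>0$. An Orlicz function is a convex function $\varphi:[0,\infty)\to[0,\infty]$ with $\varphi(0)=0$, $\varphi(s)\to\infty$ as $s\to\infty$, and $\varphi(s)<\infty$ for some $0<s<\infty$; it is also assumed left continuous at $b_\varphi=\sup\{s>0:\varphi(s)<\infty\}$. Its inverse is $\varphi^{-1}(u)=\sup\{s\ge 0:\varphi(s)\le u\}$, with $\varphi^{-1}(\infty)=\infty$, $1/0=\infty$, and $1/\infty=0$. $\varphi$ satisfies the $\Delta_2$-condition if there is a constant $M>0$ such that $\varphi(2s)\le M\varphi(s)$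 for all $s>0$. A weight function is a non-increasing, locally integrable (with respect to Lebesgue measure) function $h:K\to(0,\infty)$, where $K=[0,\mu(X)]$. With $I_{\varphi,h}(g)=\int_K\varphi(g^*(t))h(t)\,dt$, the Orlicz-Lorentz space is $\mathbb{L}^{\varphi,h}(\mu)=\{g\in\mathbb{L}^0: I_{\varphi,h}(\lambda g)<\infty\text{ for some }\lambda>0\}$, with norm $\|g\|_{\varphi,h}=\inf\{\lambda>0: I_{\varphi,h}(g/\lambda)\le 1\}$. A continuous map $T:(M,d)\to(M,d)$ of a metric space is Li-Yorke chaotic if there is an uncountable set $S\subset M$ such that every pair of distinct points $p,q\in S$ satisfies $\liminf_{n\to\infty}d(T^np,T^nq)=0$ and $\limsup_{n\to\infty}d(T^np,T^nq)>0$. For operators on normed spaces the metric is the norm metric. A vector $z$ is semi-irregular for a linear operator $T$ if $\liminf_{n\to\infty}\|T^nz\|=0$ and $\limsup_{n\to\infty}\|T^nz\|>0$.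
   Formalization: The measure μ is assumed finite and τ is assumed to map measurable sets to measurable sets; without finiteness (b), (c) can hold while (a), (g) fail, and without the second μ(τ^n(A)) is undefined and (c) need not imply (a). *)

theory Defs
  imports "HOL-Analysis.Analysis"
begin

section \<open>Li-Yorke chaos and semi-irregular vectors\<close>

text \<open>For use with \<open>Metric_space M d\<close>; the limits are taken in \<^typ>\<open>ereal\<close>, since orbits of
  distances may be unbounded.\<close>

definition li_yorke_chaotic :: "'p set \<Rightarrow> ('p \<Rightarrow> 'p \<Rightarrow> real) \<Rightarrow> ('p \<Rightarrow> 'p) \<Rightarrow> bool" where
  "li_yorke_chaotic M d T \<longleftrightarrow>
     T \<in> M \<rightarrow> M \<and>
     continuous_map (Metric_space.mtopology M d) (Metric_space.mtopology M d) T \<and>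
     (\<exists>S\<subseteq>M. uncountable S \<and>
        (\<forall>p\<in>S. \<forall>q\<in>S. p \<noteq> q \<longrightarrow>
           liminf (\<lambda>n. ereal (d ((T ^^ n) p) ((T ^^ n) q))) = 0 \<and>
           limsup (\<lambda>n. ereal (d ((T ^^ n) p) ((T ^^ n) q))) > 0))"

definition semi_irregular :: "('p \<Rightarrow> real) \<Rightarrow> ('p \<Rightarrow> 'p) \<Rightarrow> 'p \<Rightarrow> bool" where
  "semi_irregular nrm T z \<longleftrightarrow>
     liminf (\<lambda>n. ereal (nrm ((T ^^ n) z))) = 0 \<and>
     limsup (\<lambda>n. ereal (nrm ((T ^^ n) z))) > 0"


section \<open>Orlicz functions and weights\<close>

text \<open>An Orlicz function lives on \<open>[0,\<infinity>)\<close>; its values at negative arguments are never used.\<close>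

definition orlicz_b :: "(real \<Rightarrow> ennreal) \<Rightarrow> ereal" where
  "orlicz_b \<phi> = Sup (ereal ` {s. s > 0 \<and> \<phi> s < \<infinity>})"

definition orlicz_function :: "(real \<Rightarrow> ennreal) \<Rightarrow> bool" where
  "orlicz_function \<phi> \<longleftrightarrow>
     (\<forall>s\<ge>0. \<forall>t\<ge>0. \<forall>u\<in>{0..1}.
        \<phi> ((1 - u) * s + u * t) \<le> ennreal (1 - u) * \<phi> s + ennreal u * \<phi> t) \<and>
     \<phi> 0 = 0 \<and>
     (\<phi> \<longlongrightarrow> \<infinity>) at_top \<and>
     (\<exists>s>0. \<phi> s < \<infinity>) \<and>
     (\<forall>b::real. orlicz_b \<phi> = ereal b \<longrightarrow> (\<phi> \<longlongrightarrow> \<phi> b) (at_left b))"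

definition orlicz_inv :: "(real \<Rightarrow> ennreal) \<Rightarrow> ennreal \<Rightarrow> ennreal" where
  "orlicz_inv \<phi> u = Sup (ennreal ` {s. s \<ge> 0 \<and> \<phi> s \<le> u})"

definition Delta2 :: "(real \<Rightarrow> ennreal) \<Rightarrow> bool" where
  "Delta2 \<phi> \<longleftrightarrow> (\<exists>c::real. c > 0 \<and> (\<forall>s>0. \<phi> (2 * s) \<le> ennreal c * \<phi> s))"

text \<open>The compact real interval \<open>K = [0, \<mu>(X)]\<close>; this is used for finite measures only.\<close>

definition weight_domain :: "'a measure \<Rightarrow> real set" where
  "weight_domain M = {0..measure M (space M)}"

definition weight_function :: "'a measure \<Rightarrow> (real \<Rightarrow> real) \<Rightarrow> bool" where
  "weight_function M h \<longleftrightarrow>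
     (\<forall>t\<in>weight_domain M. h t > 0) \<and>
     antimono_on (weight_domain M) h \<and>
     (\<forall>C. compact C \<and> C \<subseteq> weight_domain M \<longrightarrow> set_integrable lborel C h)"

definition weight_integral :: "(real \<Rightarrow> real) \<Rightarrow> real \<Rightarrow> ennreal" where
  "weight_integral h m = (\<integral>\<^sup>+t\<in>{0..m}. ennreal (h t) \<partial>lborel)"


section \<open>Orlicz-Lorentz spaces\<close>

definition distr_fun :: "'a measure \<Rightarrow> ('a \<Rightarrow> 'k::real_normed_vector) \<Rightarrow> real \<Rightarrow> ennreal" where
  "distr_fun M g l = emeasure M {x \<in> space M. norm (g x) > l}"

text \<open>For a finite measure and \<open>t > 0\<close> the set below is nonempty, so that the real infimum is the
  intended one. Only \<open>t > 0\<close> matters in \<open>ol_modular\<close>.\<close>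

definition rearrangement :: "'a measure \<Rightarrow> ('a \<Rightarrow> 'k::real_normed_vector) \<Rightarrow> real \<Rightarrow> real" where
  "rearrangement M g t = Inf {l. l > 0 \<and> distr_fun M g l \<le> ennreal t}"

definition ol_modular ::
    "'a measure \<Rightarrow> (real \<Rightarrow> ennreal) \<Rightarrow> (real \<Rightarrow> real) \<Rightarrow> ('a \<Rightarrow> 'k::real_normed_vector) \<Rightarrow> ennreal" where
  "ol_modular M \<phi> h g =
     (\<integral>\<^sup>+t\<in>weight_domain M. \<phi> (rearrangement M g t) * ennreal (h t) \<partial>lborel)"

definition ol_functions ::
    "'a measure \<Rightarrow> (real \<Rightarrow> ennreal) \<Rightarrow> (real \<Rightarrow> real) \<Rightarrow> ('a \<Rightarrow> 'k::real_normed_vector) set" where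
  "ol_functions M \<phi> h =
     {g \<in> borel_measurable M. \<exists>l>0. ol_modular M \<phi> h (\<lambda>x. l *\<^sub>R g x) < \<infinity>}"

definition ol_fun_norm ::
    "'a measure \<Rightarrow> (real \<Rightarrow> ennreal) \<Rightarrow> (real \<Rightarrow> real) \<Rightarrow> ('a \<Rightarrow> 'k::real_normed_vector) \<Rightarrow> real" where
  "ol_fun_norm M \<phi> h g = Inf {l. l > 0 \<and> ol_modular M \<phi> h (\<lambda>x. g x /\<^sub>R l) \<le> 1}"

definition ae_eq :: "'a measure \<Rightarrow> (('a \<Rightarrow> 'k::real_normed_vector) \<times> ('a \<Rightarrow> 'k)) set" where
  "ae_eq M = {(f, g). f \<in> borel_measurable M \<and> g \<in> borel_measurable M \<and> (AE x in M. f x = g x)}"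

abbreviation ae_class :: "'a measure \<Rightarrow> ('a \<Rightarrow> 'k::real_normed_vector) \<Rightarrow> ('a \<Rightarrow> 'k) set" where
  "ae_class M g \<equiv> ae_eq M `` {g}"

definition ol_space ::
    "'a measure \<Rightarrow> (real \<Rightarrow> ennreal) \<Rightarrow> (real \<Rightarrow> real) \<Rightarrow> ('a \<Rightarrow> 'k::real_normed_vector) set set" where
  "ol_space M \<phi> h = ol_functions M \<phi> h // ae_eq M"

text \<open>Operations on classes, all independent of the chosen representatives
  (for \<open>comp_op\<close> because \<open>\<tau>\<close> is non-singular).\<close>

definition ol_norm ::
    "'a measure \<Rightarrow> (real \<Rightarrow> ennreal) \<Rightarrow> (real \<Rightarrow> real) \<Rightarrow> ('a \<Rightarrow> 'k::real_normed_vector) set \<Rightarrow> real" where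
  "ol_norm M \<phi> h P = the_elem (ol_fun_norm M \<phi> h ` P)"

definition ol_dist ::
    "'a measure \<Rightarrow> (real \<Rightarrow> ennreal) \<Rightarrow> (real \<Rightarrow> real) \<Rightarrow>
     ('a \<Rightarrow> 'k::real_normed_vector) set \<Rightarrow> ('a \<Rightarrow> 'k) set \<Rightarrow> real" where
  "ol_dist M \<phi> h P Q = ol_norm M \<phi> h (\<Union>f\<in>P. \<Union>g\<in>Q. ae_class M (\<lambda>x. f x - g x))"

definition comp_op ::
    "'a measure \<Rightarrow> ('a \<Rightarrow> 'a) \<Rightarrow> ('a \<Rightarrow> 'k::real_normed_vector) set \<Rightarrow> ('a \<Rightarrow> 'k) set" where
  "comp_op M \<tau> P = (\<Union>g\<in>P. ae_class M (g \<circ> \<tau>))"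


section \<open>The transformation\<close>

definition nonsingular :: "'a measure \<Rightarrow> ('a \<Rightarrow> 'a) \<Rightarrow> bool" where
  "nonsingular M \<tau> \<longleftrightarrow>
     \<tau> \<in> M \<rightarrow>\<^sub>M M \<and> (\<forall>A\<in>null_sets M. \<tau> -` A \<inter> space M \<in> null_sets M)"

text \<open>\<open>\<phi>\<^sup>-\<^sup>1(1 / \<integral>\<^sub>0\<^sup>m h)\<close> for \<open>m = \<mu>(\<tau>\<^sup>-\<^sup>n(A))\<close> and \<open>m = \<mu>(\<tau>\<^sup>n(A))\<close> respectively.
  The latter is meaningful only if \<open>\<tau>\<close> maps measurable sets to measurable sets.\<close>

definition preimage_seq ::
    "'a measure \<Rightarrow> (real \<Rightarrow> ennreal) \<Rightarrow> (real \<Rightarrow> real) \<Rightarrow> ('a \<Rightarrow> 'a) \<Rightarrow> 'a set \<Rightarrow> nat \<Rightarrow> ennreal" where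
  "preimage_seq M \<phi> h \<tau> A n =
     orlicz_inv \<phi> (1 / weight_integral h (measure M ((\<tau> ^^ n) -` A \<inter> space M)))"

definition image_seq ::
    "'a measure \<Rightarrow> (real \<Rightarrow> ennreal) \<Rightarrow> (real \<Rightarrow> real) \<Rightarrow> ('a \<Rightarrow> 'a) \<Rightarrow> 'a set \<Rightarrow> nat \<Rightarrow> ennreal" where
  "image_seq M \<phi> h \<tau> A n =
     orlicz_inv \<phi> (1 / weight_integral h (measure M ((\<tau> ^^ n) ` A)))"

end

theory Submission
  imports Defs
begin

text \<open>
  On a finite measure space the weight is bounded and bounded away from zero on the interval on
  which it acts. Therefore \<^term>\<open>weight_integral h m\<close> is small exactly if \<^term>\<open>m\<close> is, and the
  norm of an indicator function is small exactly if the measure of the set is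
  (\<open>ol_fun_norm_upper_bound\<close>, \<open>ol_fun_norm_lower_bound\<close>). Every condition of the theorem becomes a
  statement about the two sequences \<open>\<mu>(\<tau>\<^sup>-\<^sup>n(A))\<close> and \<open>\<mu>(\<tau>\<^sup>n(A))\<close> coming close to zero infinitely
  often. The lower limit in (f) is positive because the measures are bounded by that of the space.

  A scrambled set contains two points; their difference is a non-zero vector whose orbit comes
  close to zero, so (a) implies (b). If \<open>g\<close> is such a vector, then \<open>A = {|g| \<ge> d}\<close> has positive
  measure for some \<open>d > 0\<close>, and \<open>|g \<circ> \<tau>\<^sup>n| \<ge> d\<close> on \<open>\<tau>\<^sup>-\<^sup>n(A)\<close>, so these preimages have recurrently
  small measure, which is (c). Conversely, real multiples of one semi-irregular indicator function
  form an uncountable scrambled set, because their differences are again multiples of it.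

  The dynamical core is the passage from (c) or (d) to (e) and further to an oscillating set.
  If \<open>\<mu>(\<tau>\<^sup>-\<^sup>n(A))\<close> is recurrently small, then by absolute continuity it is small on long runs of
  consecutive \<open>n\<close>. Hence there are times \<open>p\<^sub>0 < p\<^sub>1 < \<dots>\<close> all of whose differences hit such runs,
  and removing from \<open>A\<close> its preimages under these differences leaves a set \<open>W\<close> of positive measure
  that is weakly wandering: the sets \<open>\<tau>\<^sup>-\<^sup>p(W)\<close> with \<open>p = p\<^sub>i\<close> are disjoint, and by injectivity so
  are the images \<open>\<tau>\<^sup>p(W)\<close>. In a finite measure space the measures of disjoint sets tend to zero,
  which gives smallness in both directions (\<open>small_in_both_directions\<close>). The same argument
  works when the images are small.

  For the oscillating set, take times \<open>n\<^sub>0 < m\<^sub>0 < n\<^sub>1 < m\<^sub>1 < \<dots>\<close> such that backward and forward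
  iterates of \<open>W\<close> are tiny at the respective differences, and let \<open>B\<close> be the union of the images of
  \<open>W\<close> under \<open>\<tau>\<^sup>n\<close> with \<open>n = n\<^sub>k\<close>. The preimage of \<open>B\<close> at time \<open>n\<^sub>k\<close> contains \<open>W\<close>, while the
  preimage at time \<open>m\<^sub>k\<close> is a union of tiny sets (\<open>oscillating_set\<close>). So the indicator function
  of \<open>B\<close> is semi-irregular.
\<close>


section \<open>Sequences that are small along long runs\<close>

definition recurrently_small :: "(nat \<Rightarrow> real) \<Rightarrow> bool" where
  "recurrently_small c \<longleftrightarrow> (\<forall>\<epsilon>>0. \<exists>\<^sub>F n in sequentially. c n < \<epsilon>)"

definition small_on_runs :: "(nat \<Rightarrow> real) \<Rightarrow> bool" where
  "small_on_runs c \<longleftrightarrow> (\<forall>\<epsilon>>0. \<forall>N. \<exists>m\<ge>1. \<forall>k\<le>N. c (m + k) < \<epsilon>)"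

lemma recurrently_small_if_subseq_tendsto_0:
  assumes "strict_mono p" and "(\<lambda>i. c (p i)) \<longlonglongrightarrow> 0"
  shows "recurrently_small c"
  unfolding recurrently_small_def frequently_sequentially
proof (intro allI impI)
  fix \<epsilon> :: real and N :: nat
  assume "\<epsilon> > 0"
  then have "\<forall>\<^sub>F i in sequentially. c (p i) < \<epsilon>"
    using assms(2) by (rule order_tendstoD(2)[rotated])
  then obtain K where "\<And>i. i \<ge> K \<Longrightarrow> c (p i) < \<epsilon>"
    by (auto simp: eventually_sequentially)
  moreover have "N \<le> p (max K N)"
    using seq_suble[OF assms(1), of "max K N"] by simp
  ultimately show "\<exists>n\<ge>N. c n < \<epsilon>"
    by (meson max.cobounded1)
qed

text \<open>The next time is chosen at distance \<open>m\<close> from the current one, where a run of length at least the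
  current time starts at \<open>m\<close>; the distances to all earlier times then lie in this run. As
  \<open>m \<ge> 1\<close>, the times increase. Different steps may use different sequences \<open>c i\<close>, so that
  backward and forward iterates can be controlled alternately.\<close>

lemma times_with_small_differences:
  assumes "\<And>i. small_on_runs (c i)" and "\<And>i. \<delta> i > 0"
  obtains p :: "nat \<Rightarrow> nat"
    where "strict_mono p" and "\<And>i j. j \<le> i \<Longrightarrow> c i (p (Suc i) - p j) < \<delta> i"
proof -
  have "\<exists>p. \<forall>i. True \<and> (p i < p (Suc i) \<and> (\<forall>k\<le>p i. c i (p (Suc i) - p i + k) < \<delta> i))"
  proof (rule dependent_nat_choice)
    fix x i :: nat
    obtain m where "m \<ge> 1" "\<forall>k\<le>x. c i (m + k) < \<delta> i"
      using assms unfolding small_on_runs_def by blast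
    then show "\<exists>y. True \<and> (x < y \<and> (\<forall>k\<le>x. c i (y - x + k) < \<delta> i))"
      by (intro exI[of _ "x + m"]) auto
  qed auto
  then obtain p where p: "\<And>i. p i < p (Suc i)"
    and small: "\<And>i k. k \<le> p i \<Longrightarrow> c i (p (Suc i) - p i + k) < \<delta> i"
    by blast
  have mono: "strict_mono p"
    by (simp add: p strict_mono_Suc_iff)
  moreover have "c i (p (Suc i) - p j) < \<delta> i" if "j \<le> i" for i j
  proof -
    have "p j \<le> p i"
      using mono that by (simp add: strict_mono_less_eq)
    then have "p (Suc i) - p j = p (Suc i) - p i + (p i - p j)"
      using p[of i] by simp
    then show ?thesis
      using small[of "p i - p j" i] by simp
  qed
  ultimately show ?thesis
    by (rule that)
qed


section \<open>Weakly wandering sets of an injective non-singular transformation\<close>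

lemma (in finite_measure) measure_disjoint_tendsto_0:
  assumes "\<And>i. A i \<in> sets M" and "disjoint_family A"
  shows "(\<lambda>i. measure M (A i)) \<longlonglongrightarrow> 0"
proof -
  have "(\<lambda>i. measure M (A i)) sums measure M (\<Union>i. A i)"
    using assms by (intro finite_measure_UNION) auto
  then show ?thesis
    by (blast intro: sums_summable summable_LIMSEQ_zero)
qed

locale injective_nonsingular = finite_measure M for M :: "'a measure" +
  fixes \<tau> :: "'a \<Rightarrow> 'a"
  assumes nonsing: "nonsingular M \<tau>"
    and inj: "inj_on \<tau> (space M)"
    and image_sets: "\<And>A. A \<in> sets M \<Longrightarrow> \<tau> ` A \<in> sets M"
begin

definition pre :: "nat \<Rightarrow> 'a set \<Rightarrow> 'a set" where
  "pre n A = (\<tau> ^^ n) -` A \<inter> space M"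

lemma measurable_iterate: "\<tau> ^^ n \<in> M \<rightarrow>\<^sub>M M"
proof (induction n)
  case (Suc n)
  have "\<tau> \<in> M \<rightarrow>\<^sub>M M"
    using nonsing by (simp add: nonsingular_def)
  with Suc show ?case
    by (simp add: measurable_comp)
qed simp

lemma iterate_in_space: "x \<in> space M \<Longrightarrow> (\<tau> ^^ n) x \<in> space M"
  using measurable_iterate[of n] by (rule measurable_space)

lemma inj_on_iterate: "inj_on (\<tau> ^^ n) (space M)"
proof (induction n)
  case (Suc n)
  have "inj_on \<tau> ((\<tau> ^^ n) ` space M)"
    using inj iterate_in_space by (blast intro: inj_on_subset)
  with Suc show ?case
    using comp_inj_on[of "\<tau> ^^ n" "space M" \<tau>] by (simp add: comp_def)
qed simp

lemma iterate_injD: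
  "(\<tau> ^^ n) x = (\<tau> ^^ n) y \<Longrightarrow> x \<in> space M \<Longrightarrow> y \<in> space M \<Longrightarrow> x = y"
  using inj_on_iterate[of n] by (auto dest: inj_onD)

lemma image_iterate_sets: "A \<in> sets M \<Longrightarrow> (\<tau> ^^ n) ` A \<in> sets M"
proof (induction n)
  case (Suc n)
  have "(\<tau> ^^ Suc n) ` A = \<tau> ` ((\<tau> ^^ n) ` A)"
    by (simp add: image_comp)
  with Suc image_sets show ?case
    by metis
qed simp

lemma pre_sets [intro, simp]: "A \<in> sets M \<Longrightarrow> pre n A \<in> sets M"
  unfolding pre_def using measurable_iterate by (rule measurable_sets)

lemma pre_null_sets: "A \<in> null_sets M \<Longrightarrow> pre n A \<in> null_sets M"
proof (induction n arbitrary: A)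
  case 0
  then have "A \<inter> space M = A"
    using sets.sets_into_space by blast
  with 0 show ?case by (simp add: pre_def)
next
  case (Suc n)
  have "pre (Suc n) A = pre n (\<tau> -` A \<inter> space M)"
    using iterate_in_space by (auto simp: pre_def)
  moreover have "\<tau> -` A \<inter> space M \<in> null_sets M"
    using nonsing Suc.prems by (simp add: nonsingular_def)
  ultimately show ?case
    using Suc.IH by simp
qed

lemma pre_add: "pre k (pre m A) = pre (m + k) A"
  using iterate_in_space by (auto simp: pre_def funpow_add)

lemma pre_image_le:
  assumes "A \<in> sets M" "k \<le> m"
  shows "pre k ((\<tau> ^^ m) ` A) = (\<tau> ^^ (m - k)) ` A"
proof -
  have A: "A \<subseteq> space M"
    using assms(1) by (rule sets.sets_into_space)
  have *: "(\<tau> ^^ m) x = (\<tau> ^^ k) ((\<tau> ^^ (m - k)) x)" for x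
    using assms(2) by (metis comp_apply funpow_add le_add_diff_inverse)
  show ?thesis
    using A iterate_in_space by (auto simp: pre_def * dest!: iterate_injD)
qed

lemma pre_image_ge:
  assumes "A \<in> sets M" "m \<le> k"
  shows "pre k ((\<tau> ^^ m) ` A) \<subseteq> pre (k - m) A"
proof
  fix x
  assume x: "x \<in> pre k ((\<tau> ^^ m) ` A)"
  have A: "A \<subseteq> space M"
    using assms(1) by (rule sets.sets_into_space)
  have "(\<tau> ^^ k) x = (\<tau> ^^ m) ((\<tau> ^^ (k - m)) x)"
    using assms(2) by (metis comp_apply funpow_add le_add_diff_inverse)
  with x A show "x \<in> pre (k - m) A"
    using iterate_in_space by (auto simp: pre_def dest!: iterate_injD)
qed

text \<open>Otherwise there are sets of measure below \<open>2\<^sup>-\<^sup>i\<close> whose preimages have measure at least \<open>\<epsilon>\<close>.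
  By Borel-Cantelli their limit superior is a null set, but its preimage has measure
  at least \<open>\<epsilon>\<close>.\<close>

lemma pre_absolutely_continuous:
  assumes "\<epsilon> > 0"
  obtains \<delta> where "\<delta> > 0" and "\<And>A. A \<in> sets M \<Longrightarrow> measure M A < \<delta> \<Longrightarrow> measure M (pre n A) < \<epsilon>"
proof (rule ccontr)
  assume "\<not> thesis"
  then have "\<exists>A. A \<in> sets M \<and> measure M A < (1/2) ^ i \<and> measure M (pre n A) \<ge> \<epsilon>" for i :: nat
    using that[of "(1/2) ^ i"] by (meson not_less zero_less_power half_gt_zero_iff zero_less_one)
  then obtain A where A: "\<And>i. A i \<in> sets M" and small: "\<And>i. measure M (A i) < (1/2) ^ i"
    and large: "\<And>i. measure M (pre n (A i)) \<ge> \<epsilon>"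
    by metis
  have "summable (\<lambda>i. measure M (A i))"
    by (rule summable_comparison_test'[of "\<lambda>i. (1/2) ^ i"]) (auto simp: less_imp_le[OF small])
  then have "limsup A \<in> null_sets M"
    using A by (intro borel_cantelli_limsup1) (auto simp: less_top[symmetric])
  then have null: "pre n (limsup A) \<in> null_sets M"
    by (rule pre_null_sets)
  define B where "B i = pre n (\<Union>j\<in>{i..}. A j)" for i
  have B: "B i \<in> sets M" for i
    unfolding B_def using A by (intro pre_sets sets.countable_UN') auto
  have "decseq B"
    by (force simp: decseq_def B_def pre_def)
  then have lim: "(\<lambda>i. measure M (B i)) \<longlonglongrightarrow> measure M (\<Inter>i. B i)"
    using B by (intro finite_Lim_measure_decseq) auto
  have "(\<Inter>i. B i) = pre n (limsup A)"
    by (auto simp: B_def pre_def limsup_INF_SUP)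
  then have "measure M (\<Inter>i. B i) = 0"
    using null by (simp add: null_setsD1 measure_def)
  moreover have "\<epsilon> \<le> measure M (B i)" for i
  proof -
    have "pre n (A i) \<subseteq> B i"
      by (auto simp: B_def pre_def)
    then have "measure M (pre n (A i)) \<le> measure M (B i)"
      using B by (rule finite_measure_mono)
    with large[of i] show ?thesis by simp
  qed
  ultimately show False
    using lim assms by (metis LIMSEQ_le_const not_less)
qed

lemma pre_absolutely_continuous_upto:
  assumes "\<epsilon> > 0"
  obtains \<delta> where "\<delta> > 0"
    and "\<And>A k. A \<in> sets M \<Longrightarrow> measure M A < \<delta> \<Longrightarrow> k \<le> N \<Longrightarrow> measure M (pre k A) < \<epsilon>"
proof -
  obtain d where d: "\<And>k. d k > 0"
    "\<And>k A. A \<in> sets M \<Longrightarrow> measure M A < d k \<Longrightarrow> measure M (pre k A) < \<epsilon>"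
  proof -
    have "\<forall>k. \<exists>\<delta>>0. \<forall>A\<in>sets M. measure M A < \<delta> \<longrightarrow> measure M (pre k A) < \<epsilon>"
      using pre_absolutely_continuous[OF assms] by metis
    then show thesis
      using that by metis
  qed
  have "Min (d ` {..N}) > 0"
    using d(1) by (subst Min_gr_iff) auto
  moreover have "measure M (pre k A) < \<epsilon>"
    if "A \<in> sets M" "measure M A < Min (d ` {..N})" "k \<le> N" for A k
    using that d(2) by simp
  ultimately show ?thesis
    by (rule that)
qed

text \<open>A set \<open>\<tau>\<^sup>-\<^sup>m(A)\<close> of very small measure has preimages \<open>\<tau>\<^sup>-\<^sup>m\<^sup>-\<^sup>k(A)\<close> of small measure: the run
  starts at \<open>m\<close>.\<close>

lemma small_on_runs_pre:
  assumes "A \<in> sets M" and "recurrently_small (\<lambda>n. measure M (pre n A))"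
  shows "small_on_runs (\<lambda>n. measure M (pre n A))"
  unfolding small_on_runs_def
proof (intro allI impI)
  fix \<epsilon> :: real and N :: nat
  assume "\<epsilon> > 0"
  then obtain \<delta> where "\<delta> > 0"
    and \<delta>: "\<And>A k. A \<in> sets M \<Longrightarrow> measure M A < \<delta> \<Longrightarrow> k \<le> N \<Longrightarrow> measure M (pre k A) < \<epsilon>"
    using pre_absolutely_continuous_upto[of \<epsilon> N] by metis
  then obtain m where "m \<ge> 1" "measure M (pre m A) < \<delta>"
    using assms(2) unfolding recurrently_small_def frequently_sequentially by blast
  then show "\<exists>m\<ge>1. \<forall>k\<le>N. measure M (pre (m + k) A) < \<epsilon>"
    using \<delta>[of "pre m A"] assms(1) by (auto simp: pre_add)
qed

text \<open>Here the preimages of a very small \<open>\<tau>\<^sup>m(A)\<close> are the earlier images \<open>\<tau>\<^sup>m\<^sup>-\<^sup>k(A)\<close>, so the run ends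
  at \<open>m\<close>.\<close>

lemma small_on_runs_image:
  assumes "A \<in> sets M" and "recurrently_small (\<lambda>n. measure M ((\<tau> ^^ n) ` A))"
  shows "small_on_runs (\<lambda>n. measure M ((\<tau> ^^ n) ` A))"
  unfolding small_on_runs_def
proof (intro allI impI)
  fix \<epsilon> :: real and N :: nat
  assume "\<epsilon> > 0"
  then obtain \<delta> where "\<delta> > 0"
    and \<delta>: "\<And>A k. A \<in> sets M \<Longrightarrow> measure M A < \<delta> \<Longrightarrow> k \<le> N \<Longrightarrow> measure M (pre k A) < \<epsilon>"
    using pre_absolutely_continuous_upto[of \<epsilon> N] by metis
  then obtain m where m: "m \<ge> Suc N" "measure M ((\<tau> ^^ m) ` A) < \<delta>"
    using assms(2) unfolding recurrently_small_def frequently_sequentially by blast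
  have "measure M ((\<tau> ^^ (m - N + k)) ` A) < \<epsilon>" if "k \<le> N" for k
  proof -
    have "pre (N - k) ((\<tau> ^^ m) ` A) = (\<tau> ^^ (m - N + k)) ` A"
      using pre_image_le[OF assms(1), of "N - k" m] m(1) that by simp
    then show ?thesis
      using \<delta>[OF image_iterate_sets[OF assms(1)] m(2), of "N - k"] by simp
  qed
  then show "\<exists>m\<ge>1. \<forall>k\<le>N. measure M ((\<tau> ^^ (m + k)) ` A) < \<epsilon>"
    using m(1) by (intro exI[of _ "m - N"]) auto
qed

text \<open>This is the Hajian-Kakutani construction of a weakly wandering set. With \<open>D\<close> the preimages or the
  images of \<open>A\<close>, those points of \<open>A\<close> are removed that enter \<open>A\<close> at the difference of two selected
  times, respectively that are reached from \<open>A\<close> at such a difference.\<close>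

lemma small_in_both_directions:
  assumes A: "A \<in> sets M" "measure M A > 0"
    and D: "\<And>n. D n \<in> sets M" "small_on_runs (\<lambda>n. measure M (D n))"
    and cover: "(\<forall>n. D n = pre n A) \<or> (\<forall>n. D n = (\<tau> ^^ n) ` A)"
  obtains W where "W \<in> sets M" "measure M W > 0"
    "recurrently_small (\<lambda>n. measure M (pre n W))"
    "recurrently_small (\<lambda>n. measure M ((\<tau> ^^ n) ` W))"
proof -
  \<comment> \<open>The \<open>i + 1\<close> differences ending in \<open>p (Suc i)\<close> cost at most \<open>\<mu>(A) / 2\<^sup>i\<^sup>+\<^sup>2\<close>, in total \<open>\<mu>(A) / 2\<close>.\<close>
  define \<delta> where "\<delta> i = measure M A / real (Suc i) * (1/2) ^ (i + 2)" for i
  have "\<delta> i > 0" for i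
    using A(2) by (simp add: \<delta>_def)
  then obtain p where p: "strict_mono p"
    and small: "\<And>i j. j \<le> i \<Longrightarrow> measure M (D (p (Suc i) - p j)) < \<delta> i"
    using times_with_small_differences[of "\<lambda>_ n. measure M (D n)" \<delta>] D(2) by metis
  define V where "V i = (\<Union>j\<in>{..i}. D (p (Suc i) - p j))" for i
  have V: "V i \<in> sets M" for i
    unfolding V_def using D(1) by (intro sets.countable_UN') auto
  have V_small: "measure M (V i) \<le> measure M A / 4 * (1/2) ^ i" for i
  proof -
    have "measure M (V i) \<le> (\<Sum>j\<in>{..i}. measure M (D (p (Suc i) - p j)))"
      unfolding V_def using D(1) by (intro finite_measure_subadditive_finite) auto
    also have "\<dots> \<le> (\<Sum>j\<in>{..i}. \<delta> i)"
      by (intro sum_mono less_imp_le[OF small]) simp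
    also have "\<dots> = measure M A / 4 * (1/2) ^ i"
    proof -
      have "real (Suc i) * (measure M A / real (Suc i)) = measure M A"
        by (metis nonzero_mult_div_cancel_left of_nat_neq_0 times_divide_eq_right)
      then have "real (Suc i) * \<delta> i = measure M A * (1/2) ^ (i + 2)"
        unfolding \<delta>_def by (metis mult.assoc)
      then show ?thesis
        by simp
    qed
    finally show ?thesis .
  qed
  have sums: "(\<lambda>i. measure M A / 4 * (1/2) ^ i) sums (measure M A / 4 * 2)"
    using geometric_sums[of "1/2 :: real"] by (intro sums_mult) simp
  have summable: "summable (\<lambda>i. measure M (V i))"
    by (rule summable_comparison_test'[OF sums_summable[OF sums]]) (use V_small in simp)
  have "measure M (\<Union>i. V i) \<le> (\<Sum>i. measure M (V i))"
    using V summable by (intro finite_measure_subadditive_countably) auto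
  also have "\<dots> \<le> measure M A / 4 * 2"
    using suminf_le[OF V_small summable sums_summable[OF sums]] sums by (simp add: sums_iff)
  finally have U: "measure M (\<Union>i. V i) \<le> measure M A / 2"
    by simp
  define W where "W = A - (\<Union>i. V i)"
  have W: "W \<in> sets M"
    unfolding W_def using A(1) V by (intro sets.Diff sets.countable_UN') auto
  have "measure M A \<le> measure M (W \<union> (\<Union>i. V i))"
    using W V by (intro finite_measure_mono sets.Un sets.countable_UN') (auto simp: W_def)
  also have "\<dots> \<le> measure M W + measure M (\<Union>i. V i)"
    using W V by (intro measure_Un_le sets.countable_UN') auto
  finally have "measure M W > 0"
    using U A(2) by simp
  have W_space: "W \<subseteq> space M"
    using W by (rule sets.sets_into_space)
  \<comment> \<open>A return of \<open>x\<close> puts \<open>x\<close> into \<open>D\<close> in the case of preimages, and its target in the case of images.\<close>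
  have no_return: "(\<tau> ^^ (p i - p j)) x \<notin> W" if "x \<in> W" "j < i" for x i j
  proof
    assume return: "(\<tau> ^^ (p i - p j)) x \<in> W"
    obtain i' where i': "i = Suc i'" "j \<le> i'"
      using \<open>j < i\<close> by (cases i) auto
    have "D (p i - p j) \<subseteq> (\<Union>i. V i)"
      using i' by (auto simp: V_def)
    moreover have "x \<in> D (p i - p j) \<or> (\<tau> ^^ (p i - p j)) x \<in> D (p i - p j)"
      using cover return \<open>x \<in> W\<close> W_space by (auto simp: W_def pre_def)
    ultimately show False
      using return \<open>x \<in> W\<close> by (auto simp: W_def)
  qed
  have split: "(\<tau> ^^ p i) x = (\<tau> ^^ p j) ((\<tau> ^^ (p i - p j)) x)"
      "(\<tau> ^^ p i) x = (\<tau> ^^ (p i - p j)) ((\<tau> ^^ p j) x)" if "j < i" for i j x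
  proof -
    have "p j < p i"
      using p that by (simp add: strict_mono_less)
    then have "p i = p j + (p i - p j)" "p i = (p i - p j) + p j"
      by simp_all
    then show "(\<tau> ^^ p i) x = (\<tau> ^^ p j) ((\<tau> ^^ (p i - p j)) x)"
      "(\<tau> ^^ p i) x = (\<tau> ^^ (p i - p j)) ((\<tau> ^^ p j) x)"
      by (metis comp_apply funpow_add)+
  qed
  have "pre (p i) W \<inter> pre (p j) W = {}" if "j < i" for i j
    using no_return[OF _ that] by (auto simp: pre_def split(2)[OF that])
  then have "disjoint_family (\<lambda>i. pre (p i) W)"
    unfolding disjoint_family_on_def by (metis Int_commute linorder_neq_iff)
  then have "(\<lambda>i. measure M (pre (p i) W)) \<longlonglongrightarrow> 0"
    using W by (intro measure_disjoint_tendsto_0) auto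
  then have pre_small: "recurrently_small (\<lambda>n. measure M (pre n W))"
    by (rule recurrently_small_if_subseq_tendsto_0[OF p])
  have "(\<tau> ^^ p i) ` W \<inter> (\<tau> ^^ p j) ` W = {}" if "j < i" for i j
  proof (rule ccontr)
    assume "(\<tau> ^^ p i) ` W \<inter> (\<tau> ^^ p j) ` W \<noteq> {}"
    then obtain x y where xy: "x \<in> W" "y \<in> W" and "(\<tau> ^^ p i) x = (\<tau> ^^ p j) y"
      by blast
    then have "(\<tau> ^^ p j) ((\<tau> ^^ (p i - p j)) x) = (\<tau> ^^ p j) y"
      using split(1)[OF \<open>j < i\<close>, of x] by simp
    then have "(\<tau> ^^ (p i - p j)) x = y"
      by (rule iterate_injD) (use xy W_space iterate_in_space in auto)
    then show False
      using no_return[OF xy(1) \<open>j < i\<close>] xy(2) by simp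
  qed
  then have "disjoint_family (\<lambda>i. (\<tau> ^^ p i) ` W)"
    unfolding disjoint_family_on_def by (metis Int_commute linorder_neq_iff)
  then have "(\<lambda>i. measure M ((\<tau> ^^ p i) ` W)) \<longlonglongrightarrow> 0"
    using W image_iterate_sets by (intro measure_disjoint_tendsto_0) auto
  then have "recurrently_small (\<lambda>n. measure M ((\<tau> ^^ n) ` W))"
    by (rule recurrently_small_if_subseq_tendsto_0[OF p])
  with W \<open>measure M W > 0\<close> pre_small show ?thesis
    by (rule that)
qed

text \<open>The times \<open>p (2 * k)\<close> serve as \<open>n\<^sub>k\<close> and the times \<open>p (2 * k + 1)\<close> as \<open>m\<^sub>k\<close>. At time \<open>m\<^sub>k\<close> the parts
  of the union with \<open>n\<^sub>j < m\<^sub>k\<close> appear as backward iterates of \<open>W\<close>, those with \<open>n\<^sub>j > m\<^sub>k\<close> as forward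
  iterates. Which of the two sequences must be small at the next time depends on the parity.\<close>

lemma oscillating_set:
  assumes W: "W \<in> sets M" "measure M W > 0"
    and pre_small: "recurrently_small (\<lambda>n. measure M (pre n W))"
    and image_small: "recurrently_small (\<lambda>n. measure M ((\<tau> ^^ n) ` W))"
  obtains B where "B \<in> sets M" "recurrently_small (\<lambda>n. measure M (pre n B))"
    "\<exists>\<^sub>F n in sequentially. measure M (pre n B) \<ge> measure M W"
proof -
  define c where "c i n = measure M (if even i then pre n W else (\<tau> ^^ n) ` W)" for i n :: nat
  have "small_on_runs (c i)" for i
    using small_on_runs_pre[OF W(1) pre_small] small_on_runs_image[OF W(1) image_small]
    by (cases "even i") (simp_all add: c_def[abs_def])
  then obtain p where p: "strict_mono p"
    and small: "\<And>i j. j \<le> i \<Longrightarrow> c i (p (Suc i) - p j) < (1/2) ^ i"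
    using times_with_small_differences[of c "\<lambda>i. (1/2) ^ i"] by auto
  define B where "B = (\<Union>j. (\<tau> ^^ p (2 * j)) ` W)"
  have B: "B \<in> sets M"
    unfolding B_def using W(1) image_iterate_sets by (intro sets.countable_UN') auto
  have pieces: "measure M (pre (p (2 * k + 1)) ((\<tau> ^^ p (2 * j)) ` W)) \<le> (1/2) ^ k * (1/2) ^ j"
    for j k
  proof (cases "j \<le> k")
    case True
    then have "p (2 * j) \<le> p (2 * k + 1)"
      using p by (simp add: strict_mono_less_eq)
    then have "measure M (pre (p (2 * k + 1)) ((\<tau> ^^ p (2 * j)) ` W))
        \<le> c (2 * k) (p (Suc (2 * k)) - p (2 * j))"
      using pre_image_ge[OF W(1)] W(1) by (auto simp: c_def intro!: finite_measure_mono)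
    also have "\<dots> \<le> (1/2) ^ (2 * k)"
      using True by (intro less_imp_le[OF small]) simp
    also have "\<dots> \<le> (1/2) ^ (k + j)"
      using True by (intro power_decreasing) auto
    finally show ?thesis by (simp add: power_add)
  next
    case False
    then obtain i where i: "j = Suc i" "k \<le> i"
      by (cases j) auto
    have "p (2 * k + 1) \<le> p (2 * j)"
      using p i by (simp add: strict_mono_less_eq)
    then have "measure M (pre (p (2 * k + 1)) ((\<tau> ^^ p (2 * j)) ` W))
        = c (2 * i + 1) (p (Suc (2 * i + 1)) - p (2 * k + 1))"
      using pre_image_le[OF W(1)] i by (simp add: c_def)
    also have "\<dots> \<le> (1/2) ^ (2 * i + 1)"
      using i by (intro less_imp_le[OF small]) simp
    also have "\<dots> \<le> (1/2) ^ (k + j)"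
      using i by (intro power_decreasing) auto
    finally show ?thesis by (simp add: power_add)
  qed
  have bound: "measure M (pre (p (2 * k + 1)) B) \<le> 2 * (1/2) ^ k" for k
  proof -
    let ?E = "\<lambda>j. pre (p (2 * k + 1)) ((\<tau> ^^ p (2 * j)) ` W)"
    have sums: "(\<lambda>j. (1/2 :: real) ^ k * (1/2) ^ j) sums ((1/2) ^ k * 2)"
      using geometric_sums[of "1/2 :: real"] by (intro sums_mult) simp
    have summable: "summable (\<lambda>j. measure M (?E j))"
      by (rule summable_comparison_test'[OF sums_summable[OF sums]]) (use pieces in simp)
    have "pre (p (2 * k + 1)) B = (\<Union>j. ?E j)"
      by (auto simp: B_def pre_def)
    then have "measure M (pre (p (2 * k + 1)) B) \<le> (\<Sum>j. measure M (?E j))"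
      using W(1) image_iterate_sets summable
      by (auto intro!: finite_measure_subadditive_countably)
    also have "\<dots> \<le> (1/2) ^ k * 2"
      using suminf_le[OF pieces summable sums_summable[OF sums]] sums by (simp add: sums_iff)
    finally show ?thesis by simp
  qed
  have "(\<lambda>k. measure M (pre (p (2 * k + 1)) B)) \<longlonglongrightarrow> 0"
  proof (rule real_tendsto_sandwich[of "\<lambda>_. 0"])
    show "(\<lambda>k. 2 * (1/2 :: real) ^ k) \<longlonglongrightarrow> 0"
      by (rule tendsto_mult_right_zero) (rule LIMSEQ_power_zero, simp)
  qed (use bound in auto)
  moreover have "strict_mono (\<lambda>k. p (2 * k + 1))" "strict_mono (\<lambda>k. p (2 * k))"
    using p by (auto simp: strict_mono_def)
  ultimately have "recurrently_small (\<lambda>n. measure M (pre n B))"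
    using recurrently_small_if_subseq_tendsto_0[of "\<lambda>k. p (2 * k + 1)"] by simp
  moreover have "\<exists>\<^sub>F n in sequentially. measure M (pre n B) \<ge> measure M W"
    unfolding frequently_sequentially
  proof
    fix N
    have "N \<le> p (2 * N)"
      using seq_suble[OF \<open>strict_mono (\<lambda>k. p (2 * k))\<close>] .
    moreover have "W \<subseteq> pre (p (2 * N)) B"
      using sets.sets_into_space[OF W(1)] by (auto simp: B_def pre_def)
    ultimately show "\<exists>n\<ge>N. measure M (pre n B) \<ge> measure M W"
      using B finite_measure_mono[of W] by blast
  qed
  ultimately show ?thesis
    using B that by blast
qed

end



section \<open>Orlicz functions under the doubling condition\<close>

locale doubling_orlicz =
  fixes \<phi> :: "real \<Rightarrow> ennreal"
  assumes orlicz: "orlicz_function \<phi>" and doubling: "Delta2 \<phi>"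
begin

lemma phi_0 [simp]: "\<phi> 0 = 0"
  using orlicz by (simp add: orlicz_function_def)

lemma phi_scale_le:
  assumes "0 \<le> u" "u \<le> 1" "0 \<le> t"
  shows "\<phi> (u * t) \<le> ennreal u * \<phi> t"
proof -
  have "\<phi> ((1 - u) * 0 + u * t) \<le> ennreal (1 - u) * \<phi> 0 + ennreal u * \<phi> t"
    using orlicz assms unfolding orlicz_function_def by (metis atLeastAtMost_iff order_refl)
  then show ?thesis by simp
qed

lemma phi_mono:
  assumes "0 \<le> s" "s \<le> t"
  shows "\<phi> s \<le> \<phi> t"
proof (cases "t = 0")
  case False
  then have "s = (s / t) * t" "0 \<le> s / t" "s / t \<le> 1"
    using assms by auto
  then have "\<phi> s \<le> ennreal (s / t) * \<phi> t"
    using phi_scale_le[of "s / t" t] assms by simp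
  also have "\<dots> \<le> 1 * \<phi> t"
    using \<open>s / t \<le> 1\<close> by (intro mult_right_mono) (auto simp: ennreal_le_1)
  finally show ?thesis by simp
qed (use assms in simp)

lemma phi_double_le:
  obtains c where "c > 0" "\<And>s. 0 \<le> s \<Longrightarrow> \<phi> (2 * s) \<le> ennreal c * \<phi> s"
proof -
  obtain c where c: "c > 0" "\<And>s. s > 0 \<Longrightarrow> \<phi> (2 * s) \<le> ennreal c * \<phi> s"
    using doubling unfolding Delta2_def by blast
  have "\<phi> (2 * s) \<le> ennreal c * \<phi> s" if "0 \<le> s" for s
    using that c(2)[of s] by (cases "s = 0") auto
  with c(1) show ?thesis by (rule that)
qed

text \<open>An Orlicz function is finite somewhere, and the doubling condition propagates this to all
  arguments.\<close>

lemma phi_finite: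
  assumes "0 \<le> s"
  shows "\<phi> s < \<infinity>"
proof -
  obtain s0 where s0: "s0 > 0" "\<phi> s0 < \<infinity>"
    using orlicz unfolding orlicz_function_def by blast
  obtain c where c: "c > 0" "\<And>s. 0 \<le> s \<Longrightarrow> \<phi> (2 * s) \<le> ennreal c * \<phi> s"
    using phi_double_le by blast
  have finite: "\<phi> (2 ^ n * s0) < \<infinity>" for n
  proof (induction n)
    case (Suc n)
    have "\<phi> (2 ^ Suc n * s0) \<le> ennreal c * \<phi> (2 ^ n * s0)"
      using c(2)[of "2 ^ n * s0"] s0 by (simp add: mult.assoc)
    also have "\<dots> < \<infinity>"
      using Suc by (simp add: ennreal_mult_less_top)
    finally show ?case .
  qed (use s0 in simp)
  obtain n where "s / s0 < 2 ^ n"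
    using real_arch_pow[of 2 "s / s0"] by auto
  then have "s \<le> 2 ^ n * s0"
    using s0 by (simp add: field_simps)
  then have "\<phi> s \<le> \<phi> (2 ^ n * s0)"
    using assms by (rule phi_mono[rotated])
  with finite[of n] show ?thesis by (rule le_less_trans[rotated])
qed

lemma phi_unbounded:
  assumes "C < \<infinity>"
  obtains s where "s > 0" "C < \<phi> s"
proof -
  have "\<forall>\<^sub>F s in at_top. C < \<phi> s"
    using orlicz assms unfolding orlicz_function_def by (metis order_tendstoD(1))
  moreover have "\<forall>\<^sub>F s in at_top. s > (0 :: real)"
    by (rule eventually_gt_at_top)
  ultimately have "\<forall>\<^sub>F s in at_top. C < \<phi> s \<and> s > 0"
    by (rule eventually_conj)
  then show ?thesis
    using that by (auto dest: eventually_happens)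
qed

text \<open>Convexity and \<^term>\<open>\<phi> 0 = 0\<close> force \<open>\<phi> s \<le> s * \<phi> 1\<close> for \<open>s \<le> 1\<close>.\<close>

lemma phi_small:
  assumes "u > 0"
  obtains s where "s > 0" "\<phi> s \<le> u"
proof -
  obtain r where r: "r \<ge> 0" "\<phi> 1 = ennreal r"
    using phi_finite[of 1] by (cases "\<phi> 1") auto
  show ?thesis
  proof (cases u)
    case (real v)
    then have v: "v > 0"
      using assms by (simp add: ennreal_less_zero_iff)
    define s where "s = min 1 (v / (r + 1))"
    have s: "s > 0" "s \<le> 1" "s * r \<le> v"
    proof -
      show "s > 0" "s \<le> 1"
        using v r by (auto simp: s_def)
      have "s * r \<le> v / (r + 1) * (r + 1)"
        using v r by (intro mult_mono) (auto simp: s_def)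
      then show "s * r \<le> v"
        using r by simp
    qed
    then have "\<phi> s \<le> ennreal (s * r)"
      using phi_scale_le[of s 1] r by (simp add: ennreal_mult)
    also have "\<dots> \<le> u"
      using real s by (simp add: ennreal_leI)
    finally show ?thesis
      using s that by blast
  next
    case top
    then show ?thesis using that[of 1] by simp
  qed
qed

lemma orlicz_inv_ge: "0 \<le> s \<Longrightarrow> \<phi> s \<le> u \<Longrightarrow> ennreal s \<le> orlicz_inv \<phi> u"
  unfolding orlicz_inv_def by (intro Sup_upper) auto

lemma orlicz_inv_le:
  assumes "0 \<le> s" "u < \<phi> s"
  shows "orlicz_inv \<phi> u \<le> ennreal s"
  unfolding orlicz_inv_def
proof (intro Sup_least, clarify)
  fix t
  assume t: "0 \<le> t" "\<phi> t \<le> u"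
  then have "\<not> s \<le> t"
    using phi_mono[of s t] assms by (metis leD order_trans)
  then show "ennreal t \<le> ennreal s"
    by (intro ennreal_leI) simp
qed

end


section \<open>Non-increasing rearrangements on a finite measure space\<close>

context finite_measure
begin

lemma distr_fun_vanishes:
  fixes g :: "'a \<Rightarrow> 'k::real_normed_vector"
  assumes [measurable]: "g \<in> borel_measurable M" and "t > 0"
  shows "\<exists>l>0. distr_fun M g l \<le> ennreal t"
proof -
  define A where "A n = {x \<in> space M. norm (g x) > real n}" for n
  have "(\<lambda>n. measure M (A n)) \<longlonglongrightarrow> measure M (\<Inter>n. A n)"
    by (rule finite_Lim_measure_decseq) (auto simp: A_def decseq_def)
  moreover have "(\<Inter>n. A n) = {}"
  proof -
    have "x \<notin> A (nat \<lceil>norm (g x)\<rceil>)" for x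
      by (simp add: A_def not_less)
    then show ?thesis by blast
  qed
  ultimately have "\<forall>\<^sub>F n in sequentially. measure M (A n) < t"
    using \<open>t > 0\<close> by (intro order_tendstoD(2)) auto
  then obtain n where "n \<ge> 1" "measure M (A n) < t"
    by (auto simp: eventually_sequentially) (metis le_add1 le_add2)
  then show ?thesis
    by (intro exI[of _ "real n"]) (simp add: distr_fun_def A_def emeasure_eq_measure ennreal_leI)
qed

lemma rearrangement_le: "0 < l \<Longrightarrow> distr_fun M g l \<le> ennreal t \<Longrightarrow> rearrangement M g t \<le> l"
  unfolding rearrangement_def by (intro cInf_lower bdd_belowI[of _ 0]) auto

lemma rearrangement_ge:
  fixes g :: "'a \<Rightarrow> 'k::real_normed_vector"
  assumes "g \<in> borel_measurable M" and "t > 0"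
    and "\<And>l. 0 < l \<Longrightarrow> distr_fun M g l \<le> ennreal t \<Longrightarrow> d \<le> l"
  shows "d \<le> rearrangement M g t"
  unfolding rearrangement_def using distr_fun_vanishes[OF assms(1,2)] assms(3)
  by (intro cInf_greatest) auto

lemma rearrangement_nonneg:
  fixes g :: "'a \<Rightarrow> 'k::real_normed_vector"
  assumes "g \<in> borel_measurable M" and "t > 0"
  shows "0 \<le> rearrangement M g t"
  using assms by (rule rearrangement_ge) simp

lemma rearrangement_antimono:
  fixes g :: "'a \<Rightarrow> 'k::real_normed_vector"
  assumes "g \<in> borel_measurable M" and "0 < s" "s \<le> t"
  shows "rearrangement M g t \<le> rearrangement M g s"
proof (rule rearrangement_ge[OF assms(1,2)])
  fix l
  assume "0 < l" "distr_fun M g l \<le> ennreal s"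
  moreover have "ennreal s \<le> ennreal t"
    using assms(3) by (rule ennreal_leI)
  ultimately show "rearrangement M g t \<le> l"
    by (intro rearrangement_le) auto
qed

lemma rearrangement_mono:
  fixes f g :: "'a \<Rightarrow> 'k::real_normed_vector"
  assumes [measurable]: "f \<in> borel_measurable M" "g \<in> borel_measurable M"
    and "t > 0" and le: "\<And>x. x \<in> space M \<Longrightarrow> norm (f x) \<le> norm (g x)"
  shows "rearrangement M f t \<le> rearrangement M g t"
proof (rule rearrangement_ge[OF assms(2,3)])
  fix l
  assume "0 < l" "distr_fun M g l \<le> ennreal t"
  moreover have "distr_fun M f l \<le> distr_fun M g l"
    unfolding distr_fun_def using le by (intro emeasure_mono) (auto intro: less_le_trans)
  ultimately show "rearrangement M f t \<le> l"
    by (intro rearrangement_le) auto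
qed

text \<open>If \<open>f\<close> exceeds \<open>k\<close> and \<open>g\<close> exceeds \<open>l\<close> only on sets of measure at most \<open>t/2\<close>, then \<open>f - g\<close> exceeds
  \<open>k + l\<close> only on their union.\<close>

lemma rearrangement_diff_le:
  fixes f g :: "'a \<Rightarrow> 'k::{real_normed_vector, second_countable_topology}"
  assumes [measurable]: "f \<in> borel_measurable M" "g \<in> borel_measurable M" and "t > 0"
  shows "rearrangement M (\<lambda>x. f x - g x) t \<le> rearrangement M f (t/2) + rearrangement M g (t/2)"
proof -
  have sum: "rearrangement M (\<lambda>x. f x - g x) t \<le> k + l"
    if "0 < k" "distr_fun M f k \<le> ennreal (t/2)" "0 < l" "distr_fun M g l \<le> ennreal (t/2)" for k l
  proof (rule rearrangement_le)
    have "distr_fun M (\<lambda>x. f x - g x) (k + l)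
        \<le> emeasure M ({x \<in> space M. norm (f x) > k} \<union> {x \<in> space M. norm (g x) > l})"
      unfolding distr_fun_def
    proof (rule emeasure_mono)
      show "{x \<in> space M. norm (f x - g x) > k + l}
          \<subseteq> {x \<in> space M. norm (f x) > k} \<union> {x \<in> space M. norm (g x) > l}"
      proof
        fix x assume "x \<in> {x \<in> space M. norm (f x - g x) > k + l}"
        then show "x \<in> {x \<in> space M. norm (f x) > k} \<union> {x \<in> space M. norm (g x) > l}"
          using norm_triangle_ineq4[of "f x" "g x"] by auto
      qed
    qed measurable
    also have "\<dots> \<le> distr_fun M f k + distr_fun M g l"
      unfolding distr_fun_def by (intro emeasure_subadditive) measurable
    also have "\<dots> \<le> ennreal (t/2) + ennreal (t/2)"
      using that by (intro add_mono) auto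
    also have "\<dots> = ennreal t"
      using \<open>t > 0\<close> by (subst ennreal_plus[symmetric]) auto
    finally show "distr_fun M (\<lambda>x. f x - g x) (k + l) \<le> ennreal t" .
  qed (use that in simp)
  have "rearrangement M (\<lambda>x. f x - g x) t - l \<le> rearrangement M f (t/2)"
    if "0 < l" "distr_fun M g l \<le> ennreal (t/2)" for l
    using sum[OF _ _ that] \<open>t > 0\<close> by (intro rearrangement_ge) (auto simp: diff_le_eq)
  then have "rearrangement M (\<lambda>x. f x - g x) t - rearrangement M f (t/2) \<le> rearrangement M g (t/2)"
    using \<open>t > 0\<close> by (intro rearrangement_ge) (auto simp: algebra_simps)
  then show ?thesis
    by simp
qed

lemma rearrangement_scale_le:
  fixes g :: "'a \<Rightarrow> 'k::real_normed_vector"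
  assumes "g \<in> borel_measurable M" and "t > 0" and "u > 0"
  shows "rearrangement M (\<lambda>x. u *\<^sub>R g x) t \<le> u * rearrangement M g t"
proof -
  have "rearrangement M (\<lambda>x. u *\<^sub>R g x) t / u \<le> rearrangement M g t"
  proof (rule rearrangement_ge[OF assms(1,2)])
    fix l
    assume l: "0 < l" "distr_fun M g l \<le> ennreal t"
    have "distr_fun M (\<lambda>x. u *\<^sub>R g x) (u * l) = distr_fun M g l"
      using \<open>u > 0\<close> by (simp add: distr_fun_def)
    then have "rearrangement M (\<lambda>x. u *\<^sub>R g x) t \<le> u * l"
      using l \<open>u > 0\<close> by (intro rearrangement_le) auto
    then show "rearrangement M (\<lambda>x. u *\<^sub>R g x) t / u \<le> l"
      using \<open>u > 0\<close> by (simp add: divide_le_eq mult.commute)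
  qed
  then show ?thesis
    using \<open>u > 0\<close> by (simp add: divide_le_eq mult.commute)
qed

end


section \<open>The modular and the norm on a finite measure space\<close>

locale orlicz_lorentz = finite_measure M + doubling_orlicz \<phi>
  for M :: "'a measure" and \<phi> :: "real \<Rightarrow> ennreal" +
  fixes h :: "real \<Rightarrow> real"
  assumes weight: "weight_function M h"
begin

abbreviation total :: real where
  "total \<equiv> measure M (space M)"

text \<open>Extending the weight by zero makes it Borel measurable on the whole line: integrability says
  nothing about its values outside of \<^term>\<open>weight_domain M\<close>.\<close>

definition weight_density :: "real \<Rightarrow> ennreal" where
  "weight_density t = ennreal (h t) * indicator (weight_domain M) t"

lemma weight_pos: "0 \<le> t \<Longrightarrow> t \<le> total \<Longrightarrow> h t > 0"
  using weight by (simp add: weight_function_def weight_domain_def)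

lemma weight_antimono: "0 \<le> s \<Longrightarrow> s \<le> t \<Longrightarrow> t \<le> total \<Longrightarrow> h t \<le> h s"
  using weight by (auto simp: weight_function_def weight_domain_def monotone_on_def)

lemma weight_density_measurable [measurable]: "weight_density \<in> borel_measurable borel"
proof -
  have "set_integrable lborel (weight_domain M) h"
    using weight by (simp add: weight_function_def weight_domain_def)
  then have [measurable]: "(\<lambda>t. indicator (weight_domain M) t *\<^sub>R h t) \<in> borel_measurable borel"
    unfolding set_integrable_def using borel_measurable_integrable by fastforce
  have "weight_density = (\<lambda>t. ennreal (indicator (weight_domain M) t *\<^sub>R h t))"
    by (auto simp: weight_density_def indicator_def)
  moreover have "(\<lambda>t. ennreal (indicator (weight_domain M) t *\<^sub>R h t)) \<in> borel_measurable borel"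
    by measurable
  ultimately show ?thesis
    by metis
qed

lemma weight_integral_eq:
  assumes "m \<le> total"
  shows "weight_integral h m = (\<integral>\<^sup>+t. indicator {0..m} t * weight_density t \<partial>lborel)"
  unfolding weight_integral_def using assms
  by (intro nn_integral_cong) (auto simp: weight_density_def weight_domain_def indicator_def)

lemma weight_integral_mono:
  assumes "m \<le> m'"
  shows "weight_integral h m \<le> weight_integral h m'"
  unfolding weight_integral_def using assms
  by (intro nn_integral_mono) (auto simp: indicator_def)

lemma weight_integral_le:
  assumes "0 \<le> m" "m \<le> total"
  shows "weight_integral h m \<le> ennreal (h 0 * m)"
proof -
  have "weight_integral h m \<le> (\<integral>\<^sup>+t. ennreal (h 0) * indicator {0..m} t \<partial>lborel)"
    unfolding weight_integral_def using assms weight_antimono[of 0]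
    by (intro nn_integral_mono) (auto simp: indicator_def intro!: ennreal_leI)
  also have "\<dots> = ennreal (h 0 * m)"
    using assms weight_pos[of 0] by (simp add: nn_integral_cmult_indicator ennreal_mult)
  finally show ?thesis .
qed

lemma weight_integral_pos:
  assumes "0 < m" "m \<le> total"
  shows "weight_integral h m > 0"
proof -
  have "0 < ennreal (h total * m)"
    using assms weight_pos[of total] by (simp add: ennreal_less_zero_iff)
  also have "\<dots> = (\<integral>\<^sup>+t. ennreal (h total) * indicator {0..m} t \<partial>lborel)"
    using assms weight_pos[of total] by (simp add: nn_integral_cmult_indicator ennreal_mult)
  also have "\<dots> \<le> weight_integral h m"
    unfolding weight_integral_def using assms weight_antimono[of _ total]
    by (intro nn_integral_mono) (auto simp: indicator_def intro!: ennreal_leI)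
  finally show ?thesis .
qed

lemma weight_integral_finite:
  assumes "0 \<le> m" "m \<le> total"
  shows "weight_integral h m < \<infinity>"
  using weight_integral_le[OF assms] by (rule le_less_trans) simp

text \<open>This holds since \<^term>\<open>weight_integral h m\<close> is at most \<^term>\<open>h 0 * m\<close>.\<close>

lemma phi_weight_integral_small:
  assumes "0 \<le> s"
  obtains \<eta> where "\<eta> > 0"
    "\<And>m. 0 \<le> m \<Longrightarrow> m \<le> total \<Longrightarrow> m < \<eta> \<Longrightarrow> \<phi> s * weight_integral h m \<le> 1"
proof -
  obtain r where r: "r \<ge> 0" "\<phi> s = ennreal r"
    using phi_finite[OF assms] by (cases "\<phi> s") auto
  have h0: "h 0 > 0"
    by (rule weight_pos) auto
  define \<eta> where "\<eta> = 1 / ((r + 1) * h 0)"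
  have "\<eta> > 0"
    using h0 r by (simp add: \<eta>_def)
  moreover have "\<phi> s * weight_integral h m \<le> 1" if "0 \<le> m" "m \<le> total" "m < \<eta>" for m
  proof -
    have "\<phi> s * weight_integral h m \<le> ennreal r * ennreal (h 0 * m)"
      using weight_integral_le[OF that(1,2)] r by (intro mult_mono) auto
    also have "\<dots> = ennreal (r * (h 0 * m))"
      using r h0 that by (simp add: ennreal_mult)
    also have "\<dots> \<le> 1"
    proof -
      have "r * (h 0 * m) \<le> (r + 1) * (h 0 * \<eta>)"
        using r h0 that by (intro mult_mono) auto
      also have "\<dots> = 1"
        using r h0 by (simp add: \<eta>_def)
      finally show ?thesis
        by (simp add: ennreal_le_1)
    qed
    finally show ?thesis .
  qed
  ultimately show ?thesis
    by (rule that)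
qed

lemma phi_weight_integral_large:
  assumes "0 < \<eta>"
  obtains s where "s > 0" "\<And>m. \<eta> \<le> m \<Longrightarrow> m \<le> total \<Longrightarrow> 1 < \<phi> s * weight_integral h m"
proof (cases "\<eta> \<le> total")
  case True
  define H where "H = weight_integral h \<eta>"
  have H: "0 < H" "H < \<infinity>"
    using True assms weight_integral_pos weight_integral_finite by (auto simp: H_def)
  then have "1 / H < \<infinity>"
    by (auto simp: ennreal_divide_eq_top_iff less_top[symmetric])
  then obtain s where s: "s > 0" "1 / H < \<phi> s"
    by (rule phi_unbounded)
  then have "1 < \<phi> s * H"
    using H by (simp add: divide_less_ennreal)
  moreover have "\<phi> s * H \<le> \<phi> s * weight_integral h m" if "\<eta> \<le> m" for m
    using weight_integral_mono[OF that] by (simp add: H_def mult_left_mono)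
  ultimately show ?thesis
    using s that by (meson order_less_le_trans)
next
  case False
  then show ?thesis using that[of 1] by auto
qed

lemma le_inverse_weight_integral_iff:
  assumes "0 \<le> m" "m \<le> total"
  shows "u \<le> 1 / weight_integral h m \<longleftrightarrow> u * weight_integral h m \<le> 1"
proof (cases "weight_integral h m = 0")
  case False
  then show ?thesis
    using divide_less_ennreal[of "weight_integral h m" 1 u] weight_integral_finite[OF assms]
    by (simp add: not_less[symmetric])
qed simp

text \<open>By the two preceding estimates, \<open>\<phi>\<^sup>-\<^sup>1(1 / \<integral>\<^sub>0\<^sup>m h)\<close> is at least \<open>s\<close> for small \<open>m\<close> and
  bounded as long as \<open>m\<close> stays away from zero.\<close>

lemma limsup_orlicz_inv_infinite_iff:
  assumes "\<And>n. 0 \<le> b n" "\<And>n. b n \<le> total"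
  shows "limsup (\<lambda>n. orlicz_inv \<phi> (1 / weight_integral h (b n))) = \<infinity> \<longleftrightarrow> recurrently_small b"
    (is "limsup ?q = \<infinity> \<longleftrightarrow> _")
proof
  assume inf: "limsup ?q = \<infinity>"
  show "recurrently_small b"
    unfolding recurrently_small_def
  proof (intro allI impI)
    fix \<epsilon> :: real
    assume "\<epsilon> > 0"
    then obtain s where s: "s > 0"
      "\<And>m. \<epsilon> \<le> m \<Longrightarrow> m \<le> total \<Longrightarrow> 1 < \<phi> s * weight_integral h m"
      by (rule phi_weight_integral_large) blast
    show "\<exists>\<^sub>F n in sequentially. b n < \<epsilon>"
    proof (rule ccontr)
      assume "\<not> (\<exists>\<^sub>F n in sequentially. b n < \<epsilon>)"
      then have "\<forall>\<^sub>F n in sequentially. \<epsilon> \<le> b n"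
        by (simp add: frequently_def not_less)
      then have "\<forall>\<^sub>F n in sequentially. ?q n \<le> ennreal s"
      proof eventually_elim
        case (elim n)
        then have "1 / weight_integral h (b n) < \<phi> s"
          using s(2)[of "b n"] le_inverse_weight_integral_iff[of "b n" "\<phi> s"] assms
          by (metis not_le)
        then show ?case
          using s by (intro orlicz_inv_le) auto
      qed
      then have "limsup ?q \<le> ennreal s"
        by (rule Limsup_bounded)
      with inf show False
        by (simp add: top_unique)
    qed
  qed
next
  assume small: "recurrently_small b"
  have "ennreal s \<le> limsup ?q" if "0 \<le> s" for s
  proof (rule ccontr)
    assume "\<not> ennreal s \<le> limsup ?q"
    then have ev: "\<forall>\<^sub>F n in sequentially. ?q n < ennreal s"
      by (intro Limsup_lessD) simp
    obtain \<eta> where "\<eta> > 0" and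
      \<eta>: "\<And>m. 0 \<le> m \<Longrightarrow> m \<le> total \<Longrightarrow> m < \<eta> \<Longrightarrow> \<phi> s * weight_integral h m \<le> 1"
      using \<open>0 \<le> s\<close> by (rule phi_weight_integral_small) blast
    then have "\<exists>\<^sub>F n in sequentially. b n < \<eta>"
      using small by (simp add: recurrently_small_def)
    then obtain n where "b n < \<eta>" "?q n < ennreal s"
      using ev by (metis (mono_tags, lifting) frequently_eventually_conj frequently_ex)
    moreover from this have "ennreal s \<le> ?q n"
      using \<eta>[of "b n"] assms that by (intro orlicz_inv_ge) (simp_all add: le_inverse_weight_integral_iff)
    ultimately show False
      by simp
  qed
  then show "limsup ?q = \<infinity>"
    by (metis ennreal_Ex_less_of_nat infinity_ennreal_def ennreal_of_nat_eq_real_of_nat leD less_top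
        of_nat_0_le_iff)
qed

text \<open>Every term is bounded below by the one for the measure of the whole space.\<close>

lemma liminf_orlicz_inv_pos:
  assumes "\<And>n. 0 \<le> b n" "\<And>n. b n \<le> total"
  shows "0 < liminf (\<lambda>n. orlicz_inv \<phi> (1 / weight_integral h (b n)))"
proof -
  have "weight_integral h total < \<infinity>"
    by (rule weight_integral_finite) auto
  then have "0 < 1 / weight_integral h total"
    by (simp add: ennreal_zero_less_divide)
  then obtain s where s: "s > 0" "\<phi> s \<le> 1 / weight_integral h total"
    by (rule phi_small)
  have "ennreal s \<le> orlicz_inv \<phi> (1 / weight_integral h (b n))" for n
  proof (rule orlicz_inv_ge)
    have "\<phi> s * weight_integral h (b n) \<le> \<phi> s * weight_integral h total"
      using assms by (intro mult_left_mono weight_integral_mono) auto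
    also have "\<dots> \<le> 1"
      using s(2) by (simp add: le_inverse_weight_integral_iff)
    finally show "\<phi> s \<le> 1 / weight_integral h (b n)"
      using assms by (simp add: le_inverse_weight_integral_iff)
  qed (use s in simp)
  then have "ennreal s \<le> liminf (\<lambda>n. orlicz_inv \<phi> (1 / weight_integral h (b n)))"
    by (intro Liminf_bounded) simp
  with s(1) show ?thesis
    by (metis ennreal_less_zero_iff order_less_le_trans)
qed

text \<open>At \<open>t = 0\<close> the rearrangement can be the infimum of the empty set. Cutting off \<open>t \<le> 0\<close> leaves a
  function that is zero and then non-increasing, hence Borel measurable, without changing the
  modular.\<close>

definition modular_density :: "('a \<Rightarrow> 'k::real_normed_vector) \<Rightarrow> real \<Rightarrow> ennreal" where
  "modular_density g t = (if 0 < t then \<phi> (rearrangement M g t) else 0)"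

lemma modular_density_measurable [measurable]:
  fixes g :: "'a \<Rightarrow> 'k::real_normed_vector"
  assumes "g \<in> borel_measurable M"
  shows "modular_density g \<in> borel_measurable borel"
proof (rule borel_measurableI_greater)
  fix y
  have "is_interval {t. y < modular_density g t}"
    unfolding is_interval_1
  proof clarify
    fix a b x
    assume "y < modular_density g a" "y < modular_density g b" "a \<le> x" "x \<le> b"
    moreover from this have "0 < a"
      by (simp add: modular_density_def split: if_splits)
    moreover from calculation have "\<phi> (rearrangement M g b) \<le> \<phi> (rearrangement M g x)"
      by (intro phi_mono rearrangement_antimono rearrangement_nonneg assms) auto
    ultimately show "y < modular_density g x"
      by (auto simp: modular_density_def split: if_splits)
  qed
  then show "{t \<in> space borel. y < modular_density g t} \<in> sets borel"
    by (simp add: real_interval_borel_measurable)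
qed

lemma modular_eq:
  "ol_modular M \<phi> h g = (\<integral>\<^sup>+t. modular_density g t * weight_density t \<partial>lborel)"
  unfolding ol_modular_def
proof (rule nn_integral_cong_AE)
  show "AE t in lborel. \<phi> (rearrangement M g t) * ennreal (h t) * indicator (weight_domain M) t
      = modular_density g t * weight_density t"
    using AE_lborel_singleton[of 0]
    by eventually_elim (auto simp: modular_density_def weight_density_def weight_domain_def indicator_def)
qed

lemma modular_cong_AE:
  fixes f g :: "'a \<Rightarrow> 'k::real_normed_vector"
  assumes [measurable]: "f \<in> borel_measurable M" "g \<in> borel_measurable M"
    and eq: "AE x in M. f x = g x"
  shows "ol_modular M \<phi> h f = ol_modular M \<phi> h g"
proof -
  have "distr_fun M f l = distr_fun M g l" for l
    unfolding distr_fun_def by (rule emeasure_eq_AE) (use eq in auto)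
  then show ?thesis
    by (simp add: ol_modular_def rearrangement_def)
qed

lemma modular_mono:
  fixes f g :: "'a \<Rightarrow> 'k::real_normed_vector"
  assumes "f \<in> borel_measurable M" "g \<in> borel_measurable M"
    and "\<And>x. x \<in> space M \<Longrightarrow> norm (f x) \<le> norm (g x)"
  shows "ol_modular M \<phi> h f \<le> ol_modular M \<phi> h g"
  unfolding modular_eq using assms
  by (auto simp: modular_density_def
      intro!: nn_integral_mono mult_right_mono phi_mono rearrangement_mono rearrangement_nonneg)

lemma modular_scale_le:
  fixes g :: "'a \<Rightarrow> 'k::real_normed_vector"
  assumes [measurable]: "g \<in> borel_measurable M" and u: "0 < u" "u \<le> 1"
  shows "ol_modular M \<phi> h (\<lambda>x. u *\<^sub>R g x) \<le> ennreal u * ol_modular M \<phi> h g"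
proof -
  have "modular_density (\<lambda>x. u *\<^sub>R g x) t \<le> ennreal u * modular_density g t" for t
  proof (cases "0 < t")
    case True
    have "\<phi> (rearrangement M (\<lambda>x. u *\<^sub>R g x) t) \<le> \<phi> (u * rearrangement M g t)"
      using True u by (intro phi_mono rearrangement_scale_le rearrangement_nonneg) auto
    also have "\<dots> \<le> ennreal u * \<phi> (rearrangement M g t)"
      using True u by (intro phi_scale_le rearrangement_nonneg) auto
    finally show ?thesis
      using True by (simp add: modular_density_def)
  qed (simp add: modular_density_def)
  then have "ol_modular M \<phi> h (\<lambda>x. u *\<^sub>R g x)
      \<le> (\<integral>\<^sup>+t. ennreal u * (modular_density g t * weight_density t) \<partial>lborel)"
    unfolding modular_eq mult.assoc[symmetric] by (intro nn_integral_mono mult_right_mono) auto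
  also have "\<dots> = ennreal u * ol_modular M \<phi> h g"
    unfolding modular_eq by (rule nn_integral_cmult) measurable
  finally show ?thesis .
qed

text \<open>The rearrangement is at most \<open>c\<close>, and it vanishes beyond the measure of \<open>A\<close>.\<close>

lemma modular_le_of_support:
  fixes g :: "'a \<Rightarrow> 'k::real_normed_vector"
  assumes g [measurable]: "g \<in> borel_measurable M" and A: "A \<in> sets M" and "c > 0"
    and bound: "\<And>x. x \<in> space M \<Longrightarrow> norm (g x) \<le> c * indicator A x"
  shows "ol_modular M \<phi> h g \<le> \<phi> c * weight_integral h (measure M A)"
proof -
  have density: "modular_density g t \<le> \<phi> c * indicator {0..measure M A} t" for t
  proof (cases "0 < t")
    case True
    show ?thesis
    proof (cases "t \<le> measure M A")
      case True
      have "{x \<in> space M. norm (g x) > c} = {}"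
        using order_trans[OF bound, of _ c] \<open>c > 0\<close>
        by (auto simp: indicator_def not_less)
      then have "distr_fun M g c \<le> ennreal t"
        unfolding distr_fun_def by (metis emeasure_empty zero_le)
      then have "\<phi> (rearrangement M g t) \<le> \<phi> c"
        using \<open>0 < t\<close> \<open>c > 0\<close> by (intro phi_mono rearrangement_nonneg rearrangement_le) auto
      then show ?thesis
        using True \<open>0 < t\<close> by (simp add: modular_density_def)
    next
      case False
      have "rearrangement M g t \<le> 0 + e" if "e > 0" for e
      proof -
        have "{x \<in> space M. norm (g x) > e} \<subseteq> A"
        proof clarify
          fix x
          assume "x \<in> space M" "e < norm (g x)"
          then have "e < c * indicator A x"
            using bound[of x] by simp
          then show "x \<in> A"
            using \<open>e > 0\<close> by (cases "x \<in> A") auto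
        qed
        then have "distr_fun M g e \<le> emeasure M A"
          unfolding distr_fun_def using A by (rule emeasure_mono)
        also have "\<dots> \<le> ennreal t"
          using False by (simp add: emeasure_eq_measure ennreal_leI)
        finally show ?thesis
          using that by (simp add: rearrangement_le)
      qed
      then have "rearrangement M g t \<le> 0"
        by (rule field_le_epsilon)
      then have "rearrangement M g t = 0"
        using rearrangement_nonneg[OF g \<open>0 < t\<close>] by simp
      then show ?thesis
        by (simp add: modular_density_def)
    qed
  qed (simp add: modular_density_def)
  have "ol_modular M \<phi> h g
      \<le> (\<integral>\<^sup>+t. \<phi> c * (indicator {0..measure M A} t * weight_density t) \<partial>lborel)"
    unfolding modular_eq mult.assoc[symmetric] using density
    by (intro nn_integral_mono mult_right_mono) auto
  also have "\<dots> = \<phi> c * (\<integral>\<^sup>+t. indicator {0..measure M A} t * weight_density t \<partial>lborel)"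
    by (rule nn_integral_cmult) measurable
  also have "\<dots> = \<phi> c * weight_integral h (measure M A)"
    using bounded_measure[of A] by (simp add: weight_integral_eq)
  finally show ?thesis .
qed

text \<open>The rearrangement is at least \<open>d\<close> before the measure of \<open>A\<close>.\<close>

lemma modular_ge_of_lower_bound:
  fixes g :: "'a \<Rightarrow> 'k::real_normed_vector"
  assumes g [measurable]: "g \<in> borel_measurable M" and A: "A \<in> sets M" and "d \<ge> 0"
    and bound: "\<And>x. x \<in> A \<Longrightarrow> d \<le> norm (g x)"
  shows "\<phi> d * weight_integral h (measure M A) \<le> ol_modular M \<phi> h g"
proof -
  have density: "\<phi> d \<le> modular_density g t" if "0 < t" "t < measure M A" for t
  proof -
    have "d \<le> rearrangement M g t"
    proof (rule rearrangement_ge[OF g \<open>0 < t\<close>])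
      fix l
      assume l: "0 < l" "distr_fun M g l \<le> ennreal t"
      show "d \<le> l"
      proof (rule ccontr)
        assume "\<not> d \<le> l"
        then have "A \<subseteq> {x \<in> space M. norm (g x) > l}"
          using bound sets.sets_into_space[OF A] by force
        then have "emeasure M A \<le> distr_fun M g l"
          unfolding distr_fun_def by (intro emeasure_mono) measurable
        then have "ennreal (measure M A) \<le> ennreal t"
          using l(2) by (simp add: emeasure_eq_measure)
        with that show False
          by (simp add: ennreal_le_iff)
      qed
    qed
    then show ?thesis
      using that \<open>d \<ge> 0\<close> by (simp add: modular_density_def phi_mono)
  qed
  have "\<phi> d * weight_integral h (measure M A)
      = \<phi> d * (\<integral>\<^sup>+t. indicator {0..measure M A} t * weight_density t \<partial>lborel)"
    using bounded_measure[of A] by (simp add: weight_integral_eq)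
  also have "\<dots> = (\<integral>\<^sup>+t. \<phi> d * (indicator {0..measure M A} t * weight_density t) \<partial>lborel)"
    by (rule nn_integral_cmult[symmetric]) measurable
  also have "\<dots> \<le> ol_modular M \<phi> h g"
    unfolding modular_eq
  proof (rule nn_integral_mono_AE)
    show "AE t in lborel. \<phi> d * (indicator {0..measure M A} t * weight_density t)
        \<le> modular_density g t * weight_density t"
      using AE_lborel_singleton[of 0] AE_lborel_singleton[of "measure M A"]
      by eventually_elim (auto simp: indicator_def intro!: mult_right_mono density)
  qed
  finally show ?thesis .
qed

text \<open>Substituting \<open>t = 2 s\<close> costs a factor \<open>2\<close>, and the weight satisfies \<open>h (2 s) \<le> h s\<close>.\<close>

lemma modular_dilation_finite:
  fixes f :: "'a \<Rightarrow> 'k::real_normed_vector"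
  assumes [measurable]: "f \<in> borel_measurable M" and "ol_modular M \<phi> h f < \<infinity>"
  shows "(\<integral>\<^sup>+t. modular_density f (t/2) * weight_density t \<partial>lborel) < \<infinity>"
proof -
  have [measurable]: "modular_density f \<in> borel_measurable borel"
    by (rule modular_density_measurable) fact
  have "(\<integral>\<^sup>+t. modular_density f (t/2) * weight_density t \<partial>lborel)
      = ennreal \<bar>2\<bar> * (\<integral>\<^sup>+t. modular_density f ((0 + 2 * t)/2) * weight_density (0 + 2 * t) \<partial>lborel)"
    by (intro nn_integral_real_affine) auto
  also have "\<dots> \<le> ennreal \<bar>2\<bar> * (\<integral>\<^sup>+t. modular_density f t * weight_density t \<partial>lborel)"
  proof (intro mult_left_mono nn_integral_mono)
    fix t :: real
    have "weight_density (2 * t) \<le> weight_density t" if "0 < t"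
      using that weight_antimono[of t "2 * t"]
      by (auto simp: weight_density_def weight_domain_def indicator_def intro!: ennreal_leI)
    then show "modular_density f ((0 + 2 * t)/2) * weight_density (0 + 2 * t)
        \<le> modular_density f t * weight_density t"
      by (cases "0 < t") (auto simp: modular_density_def intro!: mult_left_mono)
  qed auto
  also have "\<dots> < \<infinity>"
    using assms(2) unfolding modular_eq[symmetric] by (simp add: ennreal_mult_less_top)
  finally show ?thesis .
qed

text \<open>The doubling condition bounds \<open>\<phi>(a + b)\<close> by \<open>\<phi>(2 max a b) \<le> c (\<phi> a + \<phi> b)\<close>, which turns the
  estimate of \<open>(f - g)\<^sup>*(t)\<close> by \<open>f\<^sup>*(t/2) + g\<^sup>*(t/2)\<close> into one of the modulars.\<close>

lemma modular_diff_finite: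
  fixes f g :: "'a \<Rightarrow> 'k::{real_normed_vector, second_countable_topology}"
  assumes [measurable]: "f \<in> borel_measurable M" "g \<in> borel_measurable M"
    and "ol_modular M \<phi> h f < \<infinity>" "ol_modular M \<phi> h g < \<infinity>"
  shows "ol_modular M \<phi> h (\<lambda>x. f x - g x) < \<infinity>"
proof -
  obtain c where c: "c > 0" "\<And>s. 0 \<le> s \<Longrightarrow> \<phi> (2 * s) \<le> ennreal c * \<phi> s"
    using phi_double_le by blast
  have density: "modular_density (\<lambda>x. f x - g x) t
      \<le> ennreal c * (modular_density f (t/2) + modular_density g (t/2))" for t
  proof (cases "0 < t")
    case True
    let ?a = "rearrangement M f (t/2)" and ?b = "rearrangement M g (t/2)"
    have nonneg: "0 \<le> ?a" "0 \<le> ?b"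
      using True by (auto intro!: rearrangement_nonneg)
    have "\<phi> (rearrangement M (\<lambda>x. f x - g x) t) \<le> \<phi> (2 * max ?a ?b)"
      using True rearrangement_diff_le[of f g t]
      by (intro phi_mono rearrangement_nonneg) (auto simp: max_def)
    also have "\<dots> \<le> ennreal c * \<phi> (max ?a ?b)"
      using nonneg by (intro c(2)) auto
    also have "\<dots> \<le> ennreal c * (\<phi> ?a + \<phi> ?b)"
      by (intro mult_left_mono) (auto simp: max_def)
    finally show ?thesis
      using True by (simp add: modular_density_def)
  qed (simp add: modular_density_def)
  have "ol_modular M \<phi> h (\<lambda>x. f x - g x)
      \<le> (\<integral>\<^sup>+t. ennreal c * (modular_density f (t/2) * weight_density t
            + modular_density g (t/2) * weight_density t) \<partial>lborel)"
    unfolding modular_eq distrib_right[symmetric] mult.assoc[symmetric] using density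
    by (intro nn_integral_mono mult_right_mono) auto
  also have "\<dots> = ennreal c * ((\<integral>\<^sup>+t. modular_density f (t/2) * weight_density t \<partial>lborel)
      + (\<integral>\<^sup>+t. modular_density g (t/2) * weight_density t \<partial>lborel))"
    by (subst nn_integral_cmult, measurable) (subst nn_integral_add, measurable)
  also have "\<dots> < \<infinity>"
    using modular_dilation_finite[of f] modular_dilation_finite[of g] assms
    by (simp add: ennreal_mult_less_top)
  finally show ?thesis .
qed

lemma ol_functions_diff:
  fixes f g :: "'a \<Rightarrow> 'k::{real_normed_vector, second_countable_topology}"
  assumes "f \<in> ol_functions M \<phi> h" "g \<in> ol_functions M \<phi> h"
  shows "(\<lambda>x. f x - g x) \<in> ol_functions M \<phi> h"
proof -
  obtain k where [measurable]: "f \<in> borel_measurable M" and k: "k > 0"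
    "ol_modular M \<phi> h (\<lambda>x. k *\<^sub>R f x) < \<infinity>"
    using assms(1) by (auto simp: ol_functions_def)
  obtain l where [measurable]: "g \<in> borel_measurable M" and l: "l > 0"
    "ol_modular M \<phi> h (\<lambda>x. l *\<^sub>R g x) < \<infinity>"
    using assms(2) by (auto simp: ol_functions_def)
  define m where "m = min k l"
  have m: "0 < m" "m \<le> k" "m \<le> l"
    using k l by (auto simp: m_def)
  have "ol_modular M \<phi> h (\<lambda>x. m *\<^sub>R f x) \<le> ol_modular M \<phi> h (\<lambda>x. k *\<^sub>R f x)"
    using m by (intro modular_mono) (auto intro!: mult_right_mono)
  moreover have "ol_modular M \<phi> h (\<lambda>x. m *\<^sub>R g x) \<le> ol_modular M \<phi> h (\<lambda>x. l *\<^sub>R g x)"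
    using m by (intro modular_mono) (auto intro!: mult_right_mono)
  ultimately have "ol_modular M \<phi> h (\<lambda>x. m *\<^sub>R f x - m *\<^sub>R g x) < \<infinity>"
    using k l by (intro modular_diff_finite) (auto intro: le_less_trans)
  then show ?thesis
    using m(1) by (auto simp: ol_functions_def scaleR_diff_right)
qed

text \<open>The infimum that defines the norm is meaningful only on this account. Scaling a function with
  finite modular down makes the modular at most one, by convexity.\<close>

lemma ol_norm_set_nonempty:
  fixes g :: "'a \<Rightarrow> 'k::real_normed_vector"
  assumes "g \<in> ol_functions M \<phi> h"
  shows "\<exists>l>0. ol_modular M \<phi> h (\<lambda>x. g x /\<^sub>R l) \<le> 1"
proof -
  obtain k where [measurable]: "g \<in> borel_measurable M" and k: "k > 0"
    "ol_modular M \<phi> h (\<lambda>x. k *\<^sub>R g x) < \<infinity>"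
    using assms by (auto simp: ol_functions_def)
  then obtain r where r: "r \<ge> 0" "ol_modular M \<phi> h (\<lambda>x. k *\<^sub>R g x) = ennreal r"
    by (cases "ol_modular M \<phi> h (\<lambda>x. k *\<^sub>R g x)") auto
  define u where "u = 1 / (r + 1)"
  have u: "0 < u" "u \<le> 1" "u * r \<le> 1"
    using r by (auto simp: u_def field_simps)
  have "ol_modular M \<phi> h (\<lambda>x. u *\<^sub>R (k *\<^sub>R g x)) \<le> ennreal u * ennreal r"
    using modular_scale_le[of "\<lambda>x. k *\<^sub>R g x" u] u r by simp
  also have "\<dots> \<le> 1"
    using u r by (simp add: ennreal_mult[symmetric] ennreal_le_1)
  finally show ?thesis
    using u k by (intro exI[of _ "1 / (u * k)"]) simp
qed

lemma ol_fun_norm_nonneg: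
  fixes g :: "'a \<Rightarrow> 'k::real_normed_vector"
  assumes "g \<in> ol_functions M \<phi> h"
  shows "0 \<le> ol_fun_norm M \<phi> h g"
  unfolding ol_fun_norm_def using ol_norm_set_nonempty[OF assms]
  by (intro cInf_greatest) auto

text \<open>If \<open>l < d / s\<close> were admissible in the infimum, where \<open>1 < \<phi> s * \<integral>\<^sub>0\<^sup>m h\<close> for all \<open>m \<ge> \<eta>\<close>, then
  \<open>g / l\<close> would exceed \<open>s\<close> on \<open>A\<close> and its modular would be greater than one.\<close>

lemma ol_fun_norm_lower_bound:
  assumes "d > 0" "\<eta> > 0"
  obtains \<epsilon> where "\<epsilon> > 0"
    "\<And>(g :: 'a \<Rightarrow> 'k::real_normed_vector) A. g \<in> ol_functions M \<phi> h \<Longrightarrow> A \<in> sets M \<Longrightarrow>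
       (\<And>x. x \<in> A \<Longrightarrow> d \<le> norm (g x)) \<Longrightarrow> \<eta> \<le> measure M A \<Longrightarrow> \<epsilon> \<le> ol_fun_norm M \<phi> h g"
proof -
  obtain s where s: "s > 0" "\<And>m. \<eta> \<le> m \<Longrightarrow> m \<le> total \<Longrightarrow> 1 < \<phi> s * weight_integral h m"
    using \<open>\<eta> > 0\<close> by (rule phi_weight_integral_large) blast
  have "d / s \<le> ol_fun_norm M \<phi> h g"
    if g: "g \<in> ol_functions M \<phi> h" and A: "A \<in> sets M"
      and bound: "\<And>x. x \<in> A \<Longrightarrow> d \<le> norm (g x)" and "\<eta> \<le> measure M A"
    for g :: "'a \<Rightarrow> 'k" and A
    unfolding ol_fun_norm_def
  proof (rule cInf_greatest)
    show "{l. 0 < l \<and> ol_modular M \<phi> h (\<lambda>x. g x /\<^sub>R l) \<le> 1} \<noteq> {}"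
      using ol_norm_set_nonempty[OF g] by auto
    fix l
    assume "l \<in> {l. 0 < l \<and> ol_modular M \<phi> h (\<lambda>x. g x /\<^sub>R l) \<le> 1}"
    then have l: "0 < l" "ol_modular M \<phi> h (\<lambda>x. g x /\<^sub>R l) \<le> 1"
      by auto
    have [measurable]: "g \<in> borel_measurable M"
      using g by (simp add: ol_functions_def)
    have "\<phi> (d / l) * weight_integral h (measure M A) \<le> ol_modular M \<phi> h (\<lambda>x. g x /\<^sub>R l)"
      using A bound l(1) \<open>d > 0\<close>
      by (intro modular_ge_of_lower_bound) (auto simp: field_simps)
    also have "\<dots> \<le> 1"
      by (rule l(2))
    also have "1 < \<phi> s * weight_integral h (measure M A)"
      using s(2) \<open>\<eta> \<le> measure M A\<close> bounded_measure by blast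
    finally have "\<phi> (d / l) * weight_integral h (measure M A)
        < \<phi> s * weight_integral h (measure M A)" .
    then have "\<not> s \<le> d / l"
      using phi_mono[of s "d / l"] s(1) by (meson leD less_imp_le mult_right_mono zero_le)
    then show "d / s \<le> l"
      using l(1) s(1) by (simp add: field_simps)
  qed
  with s(1) \<open>d > 0\<close> show ?thesis
    by (intro that[of "d / s"]) auto
qed

lemma ol_fun_norm_upper_bound:
  assumes "c > 0" "\<epsilon> > 0"
  obtains \<eta> where "\<eta> > 0"
    "\<And>(g :: 'a \<Rightarrow> 'k::real_normed_vector) A. g \<in> borel_measurable M \<Longrightarrow> A \<in> sets M \<Longrightarrow>
       (\<And>x. x \<in> space M \<Longrightarrow> norm (g x) \<le> c * indicator A x) \<Longrightarrow> measure M A < \<eta> \<Longrightarrow>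
       ol_fun_norm M \<phi> h g \<le> \<epsilon>"
proof -
  have "0 \<le> c / \<epsilon>"
    using assms by simp
  then obtain \<eta> where \<eta>: "\<eta> > 0"
    "\<And>m. 0 \<le> m \<Longrightarrow> m \<le> total \<Longrightarrow> m < \<eta> \<Longrightarrow> \<phi> (c / \<epsilon>) * weight_integral h m \<le> 1"
    by (rule phi_weight_integral_small) blast
  have "ol_fun_norm M \<phi> h g \<le> \<epsilon>"
    if [measurable]: "g \<in> borel_measurable M" and A: "A \<in> sets M"
      and bound: "\<And>x. x \<in> space M \<Longrightarrow> norm (g x) \<le> c * indicator A x" and "measure M A < \<eta>"
    for g :: "'a \<Rightarrow> 'k" and A
  proof -
    have "norm (g x /\<^sub>R \<epsilon>) \<le> c / \<epsilon> * indicator A x" if "x \<in> space M" for x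
      using bound[OF that] \<open>\<epsilon> > 0\<close> by (simp add: field_simps)
    then have "ol_modular M \<phi> h (\<lambda>x. g x /\<^sub>R \<epsilon>) \<le> \<phi> (c / \<epsilon>) * weight_integral h (measure M A)"
      using A assms by (intro modular_le_of_support) auto
    also have "\<dots> \<le> 1"
      using \<eta>(2) \<open>measure M A < \<eta>\<close> bounded_measure by simp
    finally show ?thesis
      unfolding ol_fun_norm_def using \<open>\<epsilon> > 0\<close>
      by (intro cInf_lower bdd_belowI[of _ 0]) auto
  qed
  with \<eta>(1) show ?thesis
    by (rule that)
qed

lemma bounded_in_ol_functions:
  fixes g :: "'a \<Rightarrow> 'k::real_normed_vector"
  assumes "g \<in> borel_measurable M" and "c > 0" and "\<And>x. x \<in> space M \<Longrightarrow> norm (g x) \<le> c"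
  shows "g \<in> ol_functions M \<phi> h"
proof -
  have "ol_modular M \<phi> h g \<le> \<phi> c * weight_integral h total"
    using assms by (intro modular_le_of_support) auto
  also have "\<dots> < \<infinity>"
    using phi_finite[of c] weight_integral_finite[of total] \<open>c > 0\<close>
    by (simp add: ennreal_mult_less_top)
  finally show ?thesis
    using assms(1) by (auto simp: ol_functions_def intro!: exI[of _ 1])
qed

end



section \<open>Extended real limits of non-negative sequences\<close>

lemma liminf_ereal_eq_0_iff:
  assumes "\<And>n. 0 \<le> x n"
  shows "liminf (\<lambda>n. ereal (x n)) = 0 \<longleftrightarrow> recurrently_small x"
proof
  assume lim: "liminf (\<lambda>n. ereal (x n)) = 0"
  show "recurrently_small x"
    unfolding recurrently_small_def
  proof (intro allI impI, rule ccontr)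
    fix \<epsilon> :: real
    assume "\<epsilon> > 0" "\<not> (\<exists>\<^sub>F n in sequentially. x n < \<epsilon>)"
    then have "\<forall>\<^sub>F n in sequentially. ereal \<epsilon> \<le> ereal (x n)"
      by (simp add: frequently_def not_less)
    then have "ereal \<epsilon> \<le> liminf (\<lambda>n. ereal (x n))"
      by (rule Liminf_bounded)
    with lim \<open>\<epsilon> > 0\<close> show False
      by simp
  qed
next
  assume small: "recurrently_small x"
  have "0 \<le> liminf (\<lambda>n. ereal (x n))"
    using assms by (intro Liminf_bounded) simp
  moreover have "liminf (\<lambda>n. ereal (x n)) \<le> 0"
  proof (rule ereal_le_epsilon2)
    fix \<epsilon> :: real
    assume "\<epsilon> > 0"
    show "liminf (\<lambda>n. ereal (x n)) \<le> 0 + ereal \<epsilon>"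
      unfolding add_0
    proof (rule ccontr)
      assume "\<not> liminf (\<lambda>n. ereal (x n)) \<le> ereal \<epsilon>"
      then have "\<forall>\<^sub>F n in sequentially. ereal \<epsilon> < ereal (x n)"
        by (intro less_LiminfD) simp
      then have "\<forall>\<^sub>F n in sequentially. \<not> x n < \<epsilon>"
        by eventually_elim simp
      with small \<open>\<epsilon> > 0\<close> show False
        by (simp add: recurrently_small_def frequently_def)
    qed
  qed
  ultimately show "liminf (\<lambda>n. ereal (x n)) = 0"
    by (rule antisym[rotated])
qed

lemma limsup_ereal_pos:
  assumes "\<epsilon> > 0" and "\<exists>\<^sub>F n in sequentially. \<epsilon> \<le> x n"
  shows "0 < limsup (\<lambda>n. ereal (x n))"
proof -
  have "ereal \<epsilon> \<le> limsup (\<lambda>n. ereal (x n))"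
  proof (rule ccontr)
    assume "\<not> ereal \<epsilon> \<le> limsup (\<lambda>n. ereal (x n))"
    then have "\<forall>\<^sub>F n in sequentially. ereal (x n) < ereal \<epsilon>"
      by (intro Limsup_lessD) simp
    with assms(2) show False
      by (simp add: frequently_def not_le)
  qed
  with assms(1) show ?thesis
    by (metis ereal_less(2) order_less_le_trans)
qed


section \<open>The composition operator on equivalence classes\<close>

context
  fixes M :: "'a measure"
begin

lemma in_ae_class_iff:
  "f \<in> ae_class M g \<longleftrightarrow> f \<in> borel_measurable M \<and> g \<in> borel_measurable M \<and> (AE x in M. f x = g x)"
  by (auto simp: ae_eq_def)

lemma ae_class_eqI:
  assumes "f \<in> borel_measurable M" "g \<in> borel_measurable M" "AE x in M. f x = g x"
  shows "ae_class M f = ae_class M g"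
proof -
  have "(AE x in M. k x = f x) \<longleftrightarrow> (AE x in M. k x = g x)" for k
  proof
    assume "AE x in M. k x = f x"
    with assms(3) show "AE x in M. k x = g x"
      by eventually_elim simp
  next
    assume "AE x in M. k x = g x"
    with assms(3) show "AE x in M. k x = f x"
      by eventually_elim simp
  qed
  then show ?thesis
    using assms(1,2) by (auto simp only: in_ae_class_iff set_eq_iff)
qed

lemma ae_class_self: "g \<in> borel_measurable M \<Longrightarrow> g \<in> ae_class M g"
  unfolding in_ae_class_iff by simp

lemma ae_class_eq_iff:
  assumes "f \<in> borel_measurable M" "g \<in> borel_measurable M"
  shows "ae_class M f = ae_class M g \<longleftrightarrow> (AE x in M. f x = g x)"
  using ae_class_eqI[OF assms] ae_class_self[OF assms(1)] in_ae_class_iff[of f g] by metis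

end

context orlicz_lorentz
begin

lemma in_ol_space_iff:
  fixes g :: "'a \<Rightarrow> 'k::real_normed_vector"
  assumes "g \<in> borel_measurable M"
  shows "ae_class M g \<in> ol_space M \<phi> h \<longleftrightarrow> g \<in> ol_functions M \<phi> h"
proof
  assume "ae_class M g \<in> ol_space M \<phi> h"
  then obtain f where f: "f \<in> ol_functions M \<phi> h" "ae_class M g = ae_class M f"
    by (auto simp: ol_space_def quotient_def)
  then have [measurable]: "f \<in> borel_measurable M"
    by (simp add: ol_functions_def)
  have "AE x in M. g x = f x"
    using f(2) ae_class_self[OF assms] by (simp only: in_ae_class_iff)
  then have "ol_modular M \<phi> h (\<lambda>x. l *\<^sub>R g x) = ol_modular M \<phi> h (\<lambda>x. l *\<^sub>R f x)" for l
    using assms by (intro modular_cong_AE) auto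
  then show "g \<in> ol_functions M \<phi> h"
    using f(1) assms by (simp add: ol_functions_def)
next
  assume "g \<in> ol_functions M \<phi> h"
  then show "ae_class M g \<in> ol_space M \<phi> h"
    by (auto simp: ol_space_def intro: quotientI)
qed

lemma ol_spaceE:
  fixes P :: "('a \<Rightarrow> 'k::real_normed_vector) set"
  assumes "P \<in> ol_space M \<phi> h"
  obtains g where "g \<in> ol_functions M \<phi> h" "g \<in> borel_measurable M" "P = ae_class M g"
  using assms by (auto simp: ol_space_def quotient_def ol_functions_def)

lemma ol_norm_class:
  fixes g :: "'a \<Rightarrow> 'k::real_normed_vector"
  assumes "g \<in> borel_measurable M"
  shows "ol_norm M \<phi> h (ae_class M g) = ol_fun_norm M \<phi> h g"
proof -
  have "ol_fun_norm M \<phi> h f = ol_fun_norm M \<phi> h g" if "f \<in> ae_class M g" for f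
  proof -
    have "f \<in> borel_measurable M" "AE x in M. f x = g x"
      using that by (auto simp only: in_ae_class_iff)
    then have "ol_modular M \<phi> h (\<lambda>x. f x /\<^sub>R l) = ol_modular M \<phi> h (\<lambda>x. g x /\<^sub>R l)" for l
      using assms by (intro modular_cong_AE) auto
    then show ?thesis
      by (simp add: ol_fun_norm_def)
  qed
  then have "ol_fun_norm M \<phi> h ` ae_class M g = {ol_fun_norm M \<phi> h g}"
    using ae_class_self[OF assms] by blast
  then show ?thesis
    by (simp add: ol_norm_def)
qed

lemma ol_dist_class:
  fixes f g :: "'a \<Rightarrow> 'k::{real_normed_vector, second_countable_topology}"
  assumes "f \<in> borel_measurable M" "g \<in> borel_measurable M"
  shows "ol_dist M \<phi> h (ae_class M f) (ae_class M g) = ol_norm M \<phi> h (ae_class M (\<lambda>x. f x - g x))"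
proof -
  have "ae_class M (\<lambda>x. f' x - g' x) = ae_class M (\<lambda>x. f x - g x)"
    if "f' \<in> ae_class M f" "g' \<in> ae_class M g" for f' g'
  proof (rule ae_class_eqI)
    have *: "f' \<in> borel_measurable M" "AE x in M. f' x = f x"
      "g' \<in> borel_measurable M" "AE x in M. g' x = g x"
      using that by (auto simp only: in_ae_class_iff)
    then show "(\<lambda>x. f' x - g' x) \<in> borel_measurable M"
      by simp
    show "AE x in M. f' x - g' x = f x - g x"
      using *(2,4) by eventually_elim simp
  qed (use assms in simp)
  then have "(\<Union>f'\<in>ae_class M f. \<Union>g'\<in>ae_class M g. ae_class M (\<lambda>x. f' x - g' x))
      = ae_class M (\<lambda>x. f x - g x)"
    using ae_class_self[OF assms(1)] ae_class_self[OF assms(2)] by blast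
  then show ?thesis
    unfolding ol_dist_def by (rule arg_cong)
qed

end

locale composition_operator = injective_nonsingular M \<tau> + orlicz_lorentz M \<phi> h
  for M :: "'a measure" and \<tau> :: "'a \<Rightarrow> 'a" and \<phi> :: "real \<Rightarrow> ennreal" and h :: "real \<Rightarrow> real"
begin

lemma iterate_comp_measurable:
  "g \<in> borel_measurable M \<Longrightarrow> g \<circ> (\<tau> ^^ n) \<in> borel_measurable M"
  using measurable_iterate by (rule measurable_comp)

text \<open>Non-singularity makes the class of \<open>g \<circ> \<tau>\<close> independent of the representative.\<close>

lemma comp_op_class:
  fixes g :: "'a \<Rightarrow> 'k::real_normed_vector"
  assumes g: "g \<in> borel_measurable M"
  shows "comp_op M \<tau> (ae_class M g) = ae_class M (g \<circ> \<tau>)"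
proof -
  have "ae_class M (f \<circ> \<tau>) = ae_class M (g \<circ> \<tau>)" if "f \<in> ae_class M g" for f
  proof (rule ae_class_eqI)
    have f: "f \<in> borel_measurable M" "AE x in M. f x = g x"
      using that by (auto simp only: in_ae_class_iff)
    then show "f \<circ> \<tau> \<in> borel_measurable M"
      using iterate_comp_measurable[of f 1] by simp
    show "g \<circ> \<tau> \<in> borel_measurable M"
      using iterate_comp_measurable[OF g, of 1] by simp
    obtain N where N: "{x \<in> space M. f x \<noteq> g x} \<subseteq> N" "N \<in> null_sets M"
      using f(2) by (auto simp: eventually_ae_filter)
    have "pre 1 N \<in> null_sets M"
      using N(2) by (rule pre_null_sets)
    moreover have "{x \<in> space M. (f \<circ> \<tau>) x \<noteq> (g \<circ> \<tau>) x} \<subseteq> pre 1 N"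
      using N(1) iterate_in_space[of _ 1] by (auto simp: pre_def)
    ultimately show "AE x in M. (f \<circ> \<tau>) x = (g \<circ> \<tau>) x"
      by (rule AE_I')
  qed
  then show ?thesis
    unfolding comp_op_def using ae_class_self[OF g] by blast
qed

lemma comp_op_iterate_class:
  fixes g :: "'a \<Rightarrow> 'k::real_normed_vector"
  assumes "g \<in> borel_measurable M"
  shows "(comp_op M \<tau> ^^ n) (ae_class M g) = ae_class M (g \<circ> (\<tau> ^^ n))"
proof (induction n)
  case (Suc n)
  have "(comp_op M \<tau> ^^ Suc n) (ae_class M g) = comp_op M \<tau> (ae_class M (g \<circ> (\<tau> ^^ n)))"
    by (subst funpow.simps, subst comp_apply, subst Suc, rule refl)
  also have "\<dots> = ae_class M (g \<circ> (\<tau> ^^ n) \<circ> \<tau>)"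
    using assms by (intro comp_op_class iterate_comp_measurable)
  also have "g \<circ> (\<tau> ^^ n) \<circ> \<tau> = g \<circ> (\<tau> ^^ Suc n)"
    by (simp add: funpow_Suc_right comp_assoc del: funpow.simps)
  finally show ?case .
qed (simp add: comp_def)

lemma ol_norm_comp_op_iterate:
  fixes g :: "'a \<Rightarrow> 'k::real_normed_vector"
  assumes "g \<in> borel_measurable M"
  shows "ol_norm M \<phi> h ((comp_op M \<tau> ^^ n) (ae_class M g)) = ol_fun_norm M \<phi> h (g \<circ> (\<tau> ^^ n))"
  using assms by (simp add: comp_op_iterate_class ol_norm_class iterate_comp_measurable del: Image_singleton)

lemma ol_dist_comp_op_iterate:
  fixes f g :: "'a \<Rightarrow> 'k::{real_normed_vector, second_countable_topology}"
  assumes "f \<in> borel_measurable M" "g \<in> borel_measurable M"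
  shows "ol_dist M \<phi> h ((comp_op M \<tau> ^^ n) (ae_class M f)) ((comp_op M \<tau> ^^ n) (ae_class M g))
    = ol_norm M \<phi> h ((comp_op M \<tau> ^^ n) (ae_class M (\<lambda>x. f x - g x)))"
proof -
  have diff: "(\<lambda>x. f x - g x) \<in> borel_measurable M"
    using assms by simp
  have "(\<lambda>x. f x - g x) \<circ> (\<tau> ^^ n) = (\<lambda>x. (f \<circ> (\<tau> ^^ n)) x - (g \<circ> (\<tau> ^^ n)) x)"
    by auto
  then show ?thesis
    unfolding comp_op_iterate_class[OF assms(1)] comp_op_iterate_class[OF assms(2)]
      comp_op_iterate_class[OF diff]
    using ol_dist_class[OF assms[THEN iterate_comp_measurable], of n n] by simp
qed

text \<open>Invariance of the space under the operator is a statement about classes; the estimates of the norm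
  need it for the functions \<open>g \<circ> \<tau>\<^sup>n\<close>.\<close>

lemma iterate_in_ol_functions:
  fixes g :: "'a \<Rightarrow> 'k::real_normed_vector"
  assumes maps: "(comp_op M \<tau> :: ('a \<Rightarrow> 'k) set \<Rightarrow> _) \<in> ol_space M \<phi> h \<rightarrow> ol_space M \<phi> h"
    and g: "g \<in> ol_functions M \<phi> h"
  shows "g \<circ> (\<tau> ^^ n) \<in> ol_functions M \<phi> h"
proof -
  have meas: "g \<in> borel_measurable M"
    using g by (simp add: ol_functions_def)
  have "(comp_op M \<tau> ^^ n) (ae_class M g) \<in> ol_space M \<phi> h"
  proof (induction n)
    case 0
    show ?case
      using in_ol_space_iff[OF meas] g by simp
  next
    case (Suc n)
    then show ?case
      using maps by auto
  qed
  then show ?thesis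
    using in_ol_space_iff[OF iterate_comp_measurable[OF meas]] by (simp add: comp_op_iterate_class[OF meas])
qed

text \<open>Since \<open>g\<close> is not almost everywhere zero, some \<open>A = {|g| \<ge> 1 / (k + 1)}\<close> has positive measure. If
  its preimages kept a measure of at least \<open>\<eta>\<close>, then the norms of \<open>g \<circ> \<tau>\<^sup>n\<close> would be bounded away
  from zero.\<close>

lemma recurrently_small_preimage_of_orbit:
  fixes g :: "'a \<Rightarrow> 'k::real_normed_vector"
  assumes meas [measurable]: "g \<in> borel_measurable M"
    and in_ol: "\<And>n. g \<circ> (\<tau> ^^ n) \<in> ol_functions M \<phi> h"
    and nonzero: "ae_class M g \<noteq> ae_class M (\<lambda>_. 0)"
    and lim: "liminf (\<lambda>n. ereal (ol_norm M \<phi> h ((comp_op M \<tau> ^^ n) (ae_class M g)))) = 0"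
  obtains A where "A \<in> sets M" "0 < measure M A" "recurrently_small (\<lambda>n. measure M (pre n A))"
proof -
  have small: "recurrently_small (\<lambda>n. ol_fun_norm M \<phi> h (g \<circ> (\<tau> ^^ n)))"
    using lim in_ol unfolding ol_norm_comp_op_iterate[OF meas]
    by (subst (asm) liminf_ereal_eq_0_iff) (auto intro: ol_fun_norm_nonneg)
  define A where "A k = {x \<in> space M. 1 / real (Suc k) \<le> norm (g x)}" for k
  have A [measurable]: "A k \<in> sets M" for k
    unfolding A_def by measurable
  have "\<exists>k. 0 < measure M (A k)"
  proof (rule ccontr)
    assume "\<not> (\<exists>k. 0 < measure M (A k))"
    then have "measure M (A k) = 0" for k
      using measure_nonneg[of M "A k"] by (metis less_le)
    then have "A k \<in> null_sets M" for k
      by (auto simp: null_sets_def emeasure_eq_measure)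
    then have "(\<Union>k. A k) \<in> null_sets M"
      by (rule null_sets_UN)
    moreover have "{x \<in> space M. g x \<noteq> 0} \<subseteq> (\<Union>k. A k)"
    proof clarify
      fix x assume "x \<in> space M" "g x \<noteq> 0"
      then obtain k where "1 / real (Suc k) < norm (g x)"
        using nat_approx_posE[of "norm (g x)"] by auto
      then show "x \<in> (\<Union>k. A k)"
        using \<open>x \<in> space M\<close> by (auto simp: A_def intro: less_imp_le)
    qed
    ultimately have "AE x in M. g x = 0"
      by (intro AE_I') auto
    then have "ae_class M g = ae_class M (\<lambda>_. 0)"
      by (intro ae_class_eqI) auto
    with nonzero show False ..
  qed
  then obtain k where k: "0 < measure M (A k)"
    by blast
  moreover have "recurrently_small (\<lambda>n. measure M (pre n (A k)))"
    unfolding recurrently_small_def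
  proof (intro allI impI, rule ccontr)
    fix \<eta> :: real
    assume "\<eta> > 0" "\<not> (\<exists>\<^sub>F n in sequentially. measure M (pre n (A k)) < \<eta>)"
    then have ev: "\<forall>\<^sub>F n in sequentially. \<eta> \<le> measure M (pre n (A k))"
      by (simp add: frequently_def not_less)
    have "1 / real (Suc k) > 0"
      by simp
    then obtain \<epsilon> where "\<epsilon> > 0" and
      \<epsilon>: "\<And>(f :: 'a \<Rightarrow> 'k) B. f \<in> ol_functions M \<phi> h \<Longrightarrow> B \<in> sets M \<Longrightarrow>
       (\<And>x. x \<in> B \<Longrightarrow> 1 / real (Suc k) \<le> norm (f x)) \<Longrightarrow> \<eta> \<le> measure M B \<Longrightarrow>
       \<epsilon> \<le> ol_fun_norm M \<phi> h f"
      using \<open>\<eta> > 0\<close> by (rule ol_fun_norm_lower_bound) blast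
    have "\<forall>\<^sub>F n in sequentially. \<epsilon> \<le> ol_fun_norm M \<phi> h (g \<circ> (\<tau> ^^ n))"
      using ev
    proof eventually_elim
      case (elim n)
      show ?case
      proof (rule \<epsilon>[OF in_ol pre_sets[OF A]])
        show "1 / real (Suc k) \<le> norm ((g \<circ> (\<tau> ^^ n)) x)" if "x \<in> pre n (A k)" for x
          using that by (simp add: pre_def A_def)
      qed (rule elim)
    qed
    then have "\<not> (\<exists>\<^sub>F n in sequentially. ol_fun_norm M \<phi> h (g \<circ> (\<tau> ^^ n)) < \<epsilon>)"
      by (simp add: frequently_def not_less)
    with small \<open>\<epsilon> > 0\<close> show False
      by (auto simp: recurrently_small_def)
  qed
  ultimately show ?thesis
    using A by (rule that[rotated])
qed

text \<open>In condition (g) the indicator function whose orbit is considered may take its values in any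
  normed space with a distinguished non-zero element; so indicator functions are treated as
  multiples of a vector.\<close>

lemma indicator_eq_scaleR:
  "indicator B = (\<lambda>x. indicator B x *\<^sub>R (1 :: 'k::{real_normed_vector, zero_neq_one}))"
  by (auto simp: indicator_def)

lemma indicator_scaleR_measurable [measurable]:
  assumes "B \<in> sets M"
  shows "(\<lambda>x. indicator B x *\<^sub>R v :: 'k::real_normed_vector) \<in> borel_measurable M"
proof -
  have "(\<lambda>x. indicator B x *\<^sub>R v) = (\<lambda>x. if x \<in> B then v else 0)"
    by (auto simp: indicator_def)
  then show ?thesis
    using assms by simp
qed

lemma indicator_scaleR_iterate_norm:
  "x \<in> space M \<Longrightarrow>
    norm (((\<lambda>x. indicator B x *\<^sub>R v) \<circ> (\<tau> ^^ n)) x) = norm v * indicator (pre n B) x"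
  by (simp add: pre_def indicator_def)

lemma indicator_scaleR_iterate_in_ol_functions:
  fixes v :: "'k::real_normed_vector"
  assumes "B \<in> sets M"
  shows "(\<lambda>x. indicator B x *\<^sub>R v) \<circ> (\<tau> ^^ n) \<in> ol_functions M \<phi> h"
proof (rule bounded_in_ol_functions[of _ "norm v + 1"])
  show "(\<lambda>x. indicator B x *\<^sub>R v) \<circ> (\<tau> ^^ n) \<in> borel_measurable M"
    by (intro iterate_comp_measurable indicator_scaleR_measurable assms)
  show "norm (((\<lambda>x. indicator B x *\<^sub>R v) \<circ> (\<tau> ^^ n)) x) \<le> norm v + 1" if "x \<in> space M" for x
    unfolding indicator_scaleR_iterate_norm[OF that] by (simp add: indicator_def)
qed (use norm_ge_zero[of v] in linarith)

lemma indicator_scaleR_semi_irregular: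
  fixes v :: "'k::real_normed_vector"
  assumes B [measurable]: "B \<in> sets M" and small: "recurrently_small (\<lambda>n. measure M (pre n B))"
    and "\<eta> > 0" and large: "\<exists>\<^sub>F n in sequentially. \<eta> \<le> measure M (pre n B)" and "v \<noteq> 0"
  shows "semi_irregular (ol_norm M \<phi> h) (comp_op M \<tau>) (ae_class M (\<lambda>x. indicator B x *\<^sub>R v))"
proof -
  define z where "z = (\<lambda>x. indicator B x *\<^sub>R v)"
  have z: "z \<in> borel_measurable M"
    unfolding z_def using B by (rule indicator_scaleR_measurable)
  have z_meas: "z \<circ> (\<tau> ^^ n) \<in> borel_measurable M" for n
    using z by (rule iterate_comp_measurable)
  have z_norm: "norm ((z \<circ> (\<tau> ^^ n)) x) = norm v * indicator (pre n B) x" if "x \<in> space M" for n x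
    using that unfolding z_def by (rule indicator_scaleR_iterate_norm)
  have z_in: "z \<circ> (\<tau> ^^ n) \<in> ol_functions M \<phi> h" for n
    unfolding z_def using B by (rule indicator_scaleR_iterate_in_ol_functions)
  define N where "N n = ol_fun_norm M \<phi> h (z \<circ> (\<tau> ^^ n))" for n
  have N_nonneg: "0 \<le> N n" for n
    unfolding N_def using z_in by (rule ol_fun_norm_nonneg)
  have v: "norm v > 0"
    using \<open>v \<noteq> 0\<close> by simp
  have "recurrently_small N"
    unfolding recurrently_small_def
  proof (intro allI impI)
    fix \<epsilon> :: real
    assume "\<epsilon> > 0"
    then have "\<epsilon> / 2 > 0"
      by simp
    with v obtain \<delta> where "\<delta> > 0" and
      \<delta>: "\<And>(f :: 'a \<Rightarrow> 'k) A. f \<in> borel_measurable M \<Longrightarrow> A \<in> sets M \<Longrightarrow>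
       (\<And>x. x \<in> space M \<Longrightarrow> norm (f x) \<le> norm v * indicator A x) \<Longrightarrow> measure M A < \<delta> \<Longrightarrow>
       ol_fun_norm M \<phi> h f \<le> \<epsilon> / 2"
      by (rule ol_fun_norm_upper_bound) blast
    have "\<exists>\<^sub>F n in sequentially. measure M (pre n B) < \<delta>"
      using small \<open>\<delta> > 0\<close> by (simp add: recurrently_small_def)
    then show "\<exists>\<^sub>F n in sequentially. N n < \<epsilon>"
    proof (rule frequently_elim1)
      fix n
      assume "measure M (pre n B) < \<delta>"
      then have "N n \<le> \<epsilon> / 2"
        unfolding N_def using z_meas z_norm B by (intro \<delta>[of _ "pre n B"]) auto
      then show "N n < \<epsilon>"
        using \<open>\<epsilon> > 0\<close> by simp
    qed
  qed
  then have "liminf (\<lambda>n. ereal (N n)) = 0"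
    using N_nonneg by (simp add: liminf_ereal_eq_0_iff)
  moreover have "0 < limsup (\<lambda>n. ereal (N n))"
  proof -
    obtain \<epsilon> where "\<epsilon> > 0" and
      \<epsilon>: "\<And>(f :: 'a \<Rightarrow> 'k) A. f \<in> ol_functions M \<phi> h \<Longrightarrow> A \<in> sets M \<Longrightarrow>
       (\<And>x. x \<in> A \<Longrightarrow> norm v \<le> norm (f x)) \<Longrightarrow> \<eta> \<le> measure M A \<Longrightarrow> \<epsilon> \<le> ol_fun_norm M \<phi> h f"
      using v \<open>\<eta> > 0\<close> by (rule ol_fun_norm_lower_bound) blast
    have "\<exists>\<^sub>F n in sequentially. \<epsilon> \<le> N n"
      using large
    proof (rule frequently_elim1)
      fix n
      assume "\<eta> \<le> measure M (pre n B)"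
      moreover have "norm v \<le> norm ((z \<circ> (\<tau> ^^ n)) x)" if "x \<in> pre n B" for x
        using that z_norm[of x n] by (simp add: pre_def indicator_def)
      ultimately show "\<epsilon> \<le> N n"
        unfolding N_def using z_in B by (intro \<epsilon>[of _ "pre n B"]) auto
    qed
    with \<open>\<epsilon> > 0\<close> show ?thesis
      by (rule limsup_ereal_pos)
  qed
  ultimately show ?thesis
    unfolding semi_irregular_def z_def[symmetric] ol_norm_comp_op_iterate[OF z] N_def by blast
qed

text \<open>The scrambled set consists of all real multiples of the indicator function of \<open>B\<close>. By linearity
  the distance of two orbits is the norm of the orbit of the multiple by \<open>r - s\<close>, which is
  semi-irregular.\<close>

lemma li_yorke_chaotic_if_oscillating:
  fixes L :: "('a \<Rightarrow> 'k::{real_normed_field, second_countable_topology}) set set"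
  assumes L: "L = ol_space M \<phi> h" and maps: "comp_op M \<tau> \<in> L \<rightarrow> L"
    and cont: "continuous_map (Metric_space.mtopology L (ol_dist M \<phi> h))
           (Metric_space.mtopology L (ol_dist M \<phi> h)) (comp_op M \<tau>)"
    and B [measurable]: "B \<in> sets M" and small: "recurrently_small (\<lambda>n. measure M (pre n B))"
    and "\<eta> > 0" and large: "\<exists>\<^sub>F n in sequentially. \<eta> \<le> measure M (pre n B)"
  shows "li_yorke_chaotic L (ol_dist M \<phi> h) (comp_op M \<tau>)"
proof -
  define c where "c r = ae_class M (\<lambda>x. indicator B x *\<^sub>R (of_real r :: 'k))" for r :: real
  have meas: "(\<lambda>x. indicator B x *\<^sub>R (of_real r :: 'k)) \<in> borel_measurable M" for r
    using B by (rule indicator_scaleR_measurable)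
  have "ol_dist M \<phi> h ((comp_op M \<tau> ^^ n) (c r)) ((comp_op M \<tau> ^^ n) (c s))
      = ol_norm M \<phi> h ((comp_op M \<tau> ^^ n) (c (r - s)))" for n r s
    unfolding c_def ol_dist_comp_op_iterate[OF meas meas] of_real_diff scaleR_diff_right ..
  then have scrambled: "liminf (\<lambda>n. ereal (ol_dist M \<phi> h ((comp_op M \<tau> ^^ n) (c r)) ((comp_op M \<tau> ^^ n) (c s)))) = 0"
    "limsup (\<lambda>n. ereal (ol_dist M \<phi> h ((comp_op M \<tau> ^^ n) (c r)) ((comp_op M \<tau> ^^ n) (c s)))) > 0"
    if "r \<noteq> s" for r s
    using indicator_scaleR_semi_irregular[OF B small \<open>\<eta> > 0\<close> large, of "of_real (r - s) :: 'k"] that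
    unfolding c_def[symmetric] semi_irregular_def by auto
  have "measure M B \<noteq> 0"
  proof
    assume "measure M B = 0"
    then have "B \<in> null_sets M"
      by (auto simp: null_sets_def emeasure_eq_measure)
    then have "measure M (pre n B) = 0" for n
      by (simp add: pre_null_sets null_setsD1 measure_def)
    with large \<open>\<eta> > 0\<close> show False
      by (auto dest: frequently_ex)
  qed
  have "inj c"
  proof (rule injI, rule ccontr)
    fix r s
    assume "c r = c s" "r \<noteq> s"
    then have "AE x in M. indicator B x *\<^sub>R (of_real r :: 'k) = indicator B x *\<^sub>R of_real s"
      unfolding c_def using meas by (simp only: ae_class_eq_iff)
    then have "AE x in M. x \<notin> B"
      by eventually_elim (use \<open>r \<noteq> s\<close> in \<open>auto simp: indicator_def split: if_splits\<close>)
    then have "B \<in> null_sets M"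
      using B by (simp add: AE_iff_null_sets)
    with \<open>measure M B \<noteq> 0\<close> show False
      by (simp add: null_setsD1 measure_def)
  qed
  then have "uncountable (range c)"
    using uncountable_UNIV_real countable_image_inj_eq by blast
  moreover have "range c \<subseteq> L"
    unfolding c_def L using in_ol_space_iff[OF meas] indicator_scaleR_iterate_in_ol_functions[OF B, of _ 0]
    by (auto simp: comp_def)
  moreover have "liminf (\<lambda>n. ereal (ol_dist M \<phi> h ((comp_op M \<tau> ^^ n) p) ((comp_op M \<tau> ^^ n) q))) = 0 \<and>
      limsup (\<lambda>n. ereal (ol_dist M \<phi> h ((comp_op M \<tau> ^^ n) p) ((comp_op M \<tau> ^^ n) q))) > 0"
    if pq: "p \<in> range c" "q \<in> range c" "p \<noteq> q" for p q
  proof -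
    obtain r s where rs: "p = c r" "q = c s"
      using pq(1,2) by blast
    with pq(3) have "r \<noteq> s"
      by blast
    with scrambled show ?thesis
      unfolding rs by blast
  qed
  ultimately show ?thesis
    unfolding li_yorke_chaotic_def
    by (intro conjI[OF maps] conjI[OF cont] exI[of _ "range c"]) simp
qed

lemma small_orbit_if_li_yorke_chaotic:
  fixes L :: "('a \<Rightarrow> 'k::{real_normed_field, second_countable_topology}) set set"
  assumes L: "L = ol_space M \<phi> h" and chaotic: "li_yorke_chaotic L (ol_dist M \<phi> h) (comp_op M \<tau>)"
  shows "\<exists>g\<in>L. g \<noteq> ae_class M (\<lambda>_. 0) \<and>
             liminf (\<lambda>n. ereal (ol_norm M \<phi> h ((comp_op M \<tau> ^^ n) g))) = 0"
proof -
  obtain S where S: "S \<subseteq> L" "uncountable S" and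
    scrambled: "\<forall>p\<in>S. \<forall>q\<in>S. p \<noteq> q \<longrightarrow>
      liminf (\<lambda>n. ereal (ol_dist M \<phi> h ((comp_op M \<tau> ^^ n) p) ((comp_op M \<tau> ^^ n) q))) = 0 \<and>
      limsup (\<lambda>n. ereal (ol_dist M \<phi> h ((comp_op M \<tau> ^^ n) p) ((comp_op M \<tau> ^^ n) q))) > 0"
    using chaotic unfolding li_yorke_chaotic_def by (elim conjE exE)
  obtain p where "p \<in> S"
    using S(2) by (metis countable_empty equals0I)
  moreover have "S \<noteq> {p}"
    using S(2) by auto
  ultimately obtain q where pq: "p \<in> S" "q \<in> S" "p \<noteq> q"
    by blast
  obtain f where f: "f \<in> ol_functions M \<phi> h" "f \<in> borel_measurable M" "p = ae_class M f"
    using pq S(1) unfolding L by (blast elim: ol_spaceE)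
  obtain g where g: "g \<in> ol_functions M \<phi> h" "g \<in> borel_measurable M" "q = ae_class M g"
    using pq S(1) unfolding L by (blast elim: ol_spaceE)
  define k where "k = (\<lambda>x. f x - g x)"
  have k: "k \<in> borel_measurable M"
    using f g by (simp add: k_def)
  have "ae_class M k \<in> L"
    unfolding L in_ol_space_iff[OF k] using f g by (simp add: k_def ol_functions_diff)
  moreover have "ae_class M k \<noteq> ae_class M (\<lambda>_. 0)"
  proof
    assume "ae_class M k = ae_class M (\<lambda>_. 0)"
    then have "AE x in M. k x = 0"
      using k by (simp only: ae_class_eq_iff borel_measurable_const)
    then have "AE x in M. f x = g x"
      by eventually_elim (simp add: k_def)
    with f g pq(3) show False
      using ae_class_eqI by blast
  qed
  moreover have "liminf (\<lambda>n. ereal (ol_norm M \<phi> h ((comp_op M \<tau> ^^ n) (ae_class M k)))) = 0"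
    using scrambled[rule_format, OF pq, THEN conjunct1] f g unfolding k_def by (simp only: ol_dist_comp_op_iterate)
  ultimately show ?thesis
    by (intro bexI[of _ "ae_class M k"] conjI)
qed

text \<open>The orbit of the zero class consists of vectors of norm zero: the indicator function of the empty
  set has arbitrarily small norm.\<close>

lemma semi_irregular_nonzero:
  fixes P :: "('a \<Rightarrow> 'k::real_normed_vector) set"
  assumes "semi_irregular (ol_norm M \<phi> h) (comp_op M \<tau>) P"
  shows "P \<noteq> ae_class M (\<lambda>_. 0)"
proof
  assume P: "P = ae_class M (\<lambda>_. 0)"
  have zero: "(\<lambda>_. 0 :: 'k) \<in> borel_measurable M"
    by simp
  have "ol_fun_norm M \<phi> h (\<lambda>_. 0 :: 'k) \<le> \<epsilon>" if "\<epsilon> > 0" for \<epsilon>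
  proof -
    obtain \<eta> where "\<eta> > 0" and
      "\<And>(g :: 'a \<Rightarrow> 'k) A. g \<in> borel_measurable M \<Longrightarrow> A \<in> sets M \<Longrightarrow>
       (\<And>x. x \<in> space M \<Longrightarrow> norm (g x) \<le> 1 * indicator A x) \<Longrightarrow> measure M A < \<eta> \<Longrightarrow>
       ol_fun_norm M \<phi> h g \<le> \<epsilon>"
      using zero_less_one \<open>\<epsilon> > 0\<close> by (rule ol_fun_norm_upper_bound) blast
    from this(2)[of "\<lambda>_. 0" "{}"] \<open>\<eta> > 0\<close> show ?thesis
      by simp
  qed
  then have "ol_fun_norm M \<phi> h (\<lambda>_. 0 :: 'k) \<le> 0"
    by (metis field_le_epsilon add_0)
  then have "limsup (\<lambda>n. ereal (ol_norm M \<phi> h ((comp_op M \<tau> ^^ n) P))) \<le> 0"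
    unfolding P ol_norm_comp_op_iterate[OF zero] by (intro Limsup_bounded) (simp add: comp_def)
  with assms show False
    by (simp add: semi_irregular_def not_less[symmetric])
qed

lemma recurrently_small_preimage_of_semi_irregular:
  fixes v :: "'k::real_normed_vector"
  assumes B: "B \<in> sets M"
    and irregular: "semi_irregular (ol_norm M \<phi> h) (comp_op M \<tau>)
      (ae_class M (\<lambda>x. indicator B x *\<^sub>R v))"
  obtains A where "A \<in> sets M" "0 < measure M A" "recurrently_small (\<lambda>n. measure M (pre n A))"
proof (rule recurrently_small_preimage_of_orbit)
  show "(\<lambda>x. indicator B x *\<^sub>R v) \<in> borel_measurable M"
    using B by (rule indicator_scaleR_measurable)
  show "(\<lambda>x. indicator B x *\<^sub>R v) \<circ> (\<tau> ^^ n) \<in> ol_functions M \<phi> h" for n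
    using B by (rule indicator_scaleR_iterate_in_ol_functions)
  show "ae_class M (\<lambda>x. indicator B x *\<^sub>R v) \<noteq> ae_class M (\<lambda>_. 0)"
    using irregular by (rule semi_irregular_nonzero)
  show "liminf (\<lambda>n. ereal (ol_norm M \<phi> h ((comp_op M \<tau> ^^ n) (ae_class M (\<lambda>x. indicator B x *\<^sub>R v))))) = 0"
    using irregular by (simp add: semi_irregular_def)
qed (rule that)

lemma limsup_preimage_seq_infinite_iff:
  "limsup (preimage_seq M \<phi> h \<tau> A) = \<infinity> \<longleftrightarrow> recurrently_small (\<lambda>n. measure M (pre n A))"
  unfolding preimage_seq_def[abs_def] pre_def
  by (rule limsup_orlicz_inv_infinite_iff) (auto intro: bounded_measure)

lemma liminf_preimage_seq_pos: "0 < liminf (preimage_seq M \<phi> h \<tau> A)"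
  unfolding preimage_seq_def[abs_def]
  by (rule liminf_orlicz_inv_pos) (auto intro: bounded_measure)

lemma limsup_image_seq_infinite_iff:
  "limsup (image_seq M \<phi> h \<tau> A) = \<infinity> \<longleftrightarrow> recurrently_small (\<lambda>n. measure M ((\<tau> ^^ n) ` A))"
  unfolding image_seq_def[abs_def]
  by (rule limsup_orlicz_inv_infinite_iff) (auto intro: bounded_measure)

end


section \<open>Characterisations of Li-Yorke chaos\<close>

theorem theorem2p3:
  fixes M :: "'a measure" and \<tau> :: "'a \<Rightarrow> 'a"
    and \<phi> :: "real \<Rightarrow> ennreal" and h :: "real \<Rightarrow> real"
    and L :: "('a \<Rightarrow> 'k::{real_normed_field, second_countable_topology}) set set"
  assumes "finite_measure M"
    and "nonsingular M \<tau>" and "inj_on \<tau> (space M)"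
    and "\<forall>A\<in>sets M. \<tau> ` A \<in> sets M"
    and "orlicz_function \<phi>" and "Delta2 \<phi>"
    and "weight_function M h"
    and "L = ol_space M \<phi> h"
    and "comp_op M \<tau> \<in> L \<rightarrow> L"
    and "continuous_map (Metric_space.mtopology L (ol_dist M \<phi> h))
           (Metric_space.mtopology L (ol_dist M \<phi> h)) (comp_op M \<tau>)"
  shows "let
      a = li_yorke_chaotic L (ol_dist M \<phi> h) (comp_op M \<tau>);
      b = (\<exists>g\<in>L. g \<noteq> ae_class M (\<lambda>_. 0) \<and>
             liminf (\<lambda>n. ereal (ol_norm M \<phi> h ((comp_op M \<tau> ^^ n) g))) = 0);
      c = (\<exists>A\<in>sets M. 0 < emeasure M A \<and> emeasure M A < \<infinity> \<and>
             limsup (preimage_seq M \<phi> h \<tau> A) = \<infinity>);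
      d = (\<exists>A\<in>sets M. 0 < emeasure M A \<and> emeasure M A < \<infinity> \<and>
             limsup (image_seq M \<phi> h \<tau> A) = \<infinity>);
      e = (\<exists>A\<in>sets M. 0 < emeasure M A \<and> emeasure M A < \<infinity> \<and>
             limsup (preimage_seq M \<phi> h \<tau> A) = \<infinity> \<and>
             limsup (image_seq M \<phi> h \<tau> A) = \<infinity>);
      f = (\<exists>A\<in>sets M. 0 < emeasure M A \<and> emeasure M A < \<infinity> \<and>
             liminf (preimage_seq M \<phi> h \<tau> A) > 0 \<and>
             limsup (preimage_seq M \<phi> h \<tau> A) = \<infinity>);
      g = (\<exists>A\<in>sets M. ae_class M (indicator A) \<in> L \<and>
             semi_irregular (ol_norm M \<phi> h) (comp_op M \<tau>) (ae_class M (indicator A)))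
    in (a \<longleftrightarrow> b) \<and> (a \<longleftrightarrow> c) \<and> (a \<longleftrightarrow> d) \<and> (a \<longleftrightarrow> e) \<and> (a \<longleftrightarrow> f) \<and> (a \<longleftrightarrow> g)"
proof -
  interpret finite_measure M
    by fact
  interpret composition_operator M \<tau> \<phi> h
    by unfold_locales (use assms in blast)+
  \<comment> \<open>The implications are a \<open>\<longrightarrow>\<close> b \<open>\<longrightarrow>\<close> c \<open>\<longrightarrow>\<close> e \<open>\<longrightarrow>\<close> a, together with d \<open>\<longleftrightarrow>\<close> e, f \<open>\<longleftrightarrow>\<close> c, e \<open>\<longrightarrow>\<close> g and g \<open>\<longrightarrow>\<close> c.\<close>
  define a where "a \<longleftrightarrow> li_yorke_chaotic L (ol_dist M \<phi> h) (comp_op M \<tau>)"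
  define b where "b \<longleftrightarrow> (\<exists>g\<in>L. g \<noteq> ae_class M (\<lambda>_. 0) \<and>
             liminf (\<lambda>n. ereal (ol_norm M \<phi> h ((comp_op M \<tau> ^^ n) g))) = 0)"
  define c where "c \<longleftrightarrow> (\<exists>A\<in>sets M. 0 < emeasure M A \<and> emeasure M A < \<infinity> \<and>
             limsup (preimage_seq M \<phi> h \<tau> A) = \<infinity>)"
  define d where "d \<longleftrightarrow> (\<exists>A\<in>sets M. 0 < emeasure M A \<and> emeasure M A < \<infinity> \<and>
             limsup (image_seq M \<phi> h \<tau> A) = \<infinity>)"
  define e where "e \<longleftrightarrow> (\<exists>A\<in>sets M. 0 < emeasure M A \<and> emeasure M A < \<infinity> \<and>
             limsup (preimage_seq M \<phi> h \<tau> A) = \<infinity> \<and>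
             limsup (image_seq M \<phi> h \<tau> A) = \<infinity>)"
  define f where "f \<longleftrightarrow> (\<exists>A\<in>sets M. 0 < emeasure M A \<and> emeasure M A < \<infinity> \<and>
             liminf (preimage_seq M \<phi> h \<tau> A) > 0 \<and>
             limsup (preimage_seq M \<phi> h \<tau> A) = \<infinity>)"
  define g where "g \<longleftrightarrow> (\<exists>A\<in>sets M. ae_class M (indicator A) \<in> L \<and>
             semi_irregular (ol_norm M \<phi> h) (comp_op M \<tau>) (ae_class M (indicator A :: 'a \<Rightarrow> 'b)))"
  note L = \<open>L = ol_space M \<phi> h\<close> and maps = \<open>comp_op M \<tau> \<in> L \<rightarrow> L\<close>
  have pos_iff: "0 < emeasure M A \<and> emeasure M A < \<infinity> \<longleftrightarrow> 0 < measure M A" for A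
    by (simp add: emeasure_eq_measure)
  have c_iff: "c \<longleftrightarrow> (\<exists>A\<in>sets M. 0 < measure M A \<and> recurrently_small (\<lambda>n. measure M (pre n A)))"
    unfolding c_def limsup_preimage_seq_infinite_iff pos_iff[symmetric] by auto
  have d_iff: "d \<longleftrightarrow> (\<exists>A\<in>sets M. 0 < measure M A \<and> recurrently_small (\<lambda>n. measure M ((\<tau> ^^ n) ` A)))"
    unfolding d_def limsup_image_seq_infinite_iff pos_iff[symmetric] by auto
  have e_iff: "e \<longleftrightarrow> (\<exists>A\<in>sets M. 0 < measure M A \<and> recurrently_small (\<lambda>n. measure M (pre n A))
      \<and> recurrently_small (\<lambda>n. measure M ((\<tau> ^^ n) ` A)))"
    unfolding e_def limsup_preimage_seq_infinite_iff limsup_image_seq_infinite_iff pos_iff[symmetric]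
    by auto
  have "f \<longleftrightarrow> c"
    unfolding f_def c_def using liminf_preimage_seq_pos by simp
  moreover have "a \<longrightarrow> b"
    unfolding a_def b_def using small_orbit_if_li_yorke_chaotic[OF L] by blast
  moreover have "b \<longrightarrow> c"
  proof
    assume b
    then obtain P where P: "P \<in> L" "P \<noteq> ae_class M (\<lambda>_. 0)"
      "liminf (\<lambda>n. ereal (ol_norm M \<phi> h ((comp_op M \<tau> ^^ n) P))) = 0"
      unfolding b_def by blast
    obtain k where k: "k \<in> ol_functions M \<phi> h" "k \<in> borel_measurable M" "P = ae_class M k"
      using P(1) unfolding L by (rule ol_spaceE)
    obtain A where "A \<in> sets M" "0 < measure M A" "recurrently_small (\<lambda>n. measure M (pre n A))"
      using recurrently_small_preimage_of_orbit[OF k(2) iterate_in_ol_functions[OF _ k(1)]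
          P(2,3)[unfolded k(3)]] maps[unfolded L] by metis
    then show c
      unfolding c_iff by blast
  qed
  moreover have "g \<longrightarrow> c"
  proof
    assume g
    then obtain B where B: "B \<in> sets M"
      "semi_irregular (ol_norm M \<phi> h) (comp_op M \<tau>) (ae_class M (indicator B :: 'a \<Rightarrow> 'b))"
      unfolding g_def by (elim bexE conjE)
    obtain A where "A \<in> sets M" "0 < measure M A" "recurrently_small (\<lambda>n. measure M (pre n A))"
      by (rule recurrently_small_preimage_of_semi_irregular[OF B(1)
            B(2)[unfolded indicator_eq_scaleR[where 'k = 'b]]])
    then show c
      unfolding c_iff by blast
  qed
  moreover have "c \<longrightarrow> e"
  proof
    assume c
    then obtain A where A: "A \<in> sets M" "0 < measure M A"
      "recurrently_small (\<lambda>n. measure M (pre n A))"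
      unfolding c_iff by blast
    then show e
      unfolding e_iff
      using small_in_both_directions[OF A(1,2), of "\<lambda>n. pre n A"] small_on_runs_pre by (metis pre_sets)
  qed
  moreover have "d \<longrightarrow> e"
  proof
    assume d
    then obtain A where A: "A \<in> sets M" "0 < measure M A"
      "recurrently_small (\<lambda>n. measure M ((\<tau> ^^ n) ` A))"
      unfolding d_iff by blast
    then show e
      unfolding e_iff
      using small_in_both_directions[OF A(1,2), of "\<lambda>n. (\<tau> ^^ n) ` A"] small_on_runs_image
      by (metis image_iterate_sets)
  qed
  moreover have "e \<longrightarrow> d"
    unfolding e_def d_def by blast
  moreover have "e \<longrightarrow> a \<and> g"
  proof
    assume e
    then obtain W where "W \<in> sets M" "0 < measure M W"
      "recurrently_small (\<lambda>n. measure M (pre n W))"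
      "recurrently_small (\<lambda>n. measure M ((\<tau> ^^ n) ` W))"
      unfolding e_iff by blast
    then obtain B where B: "B \<in> sets M" "recurrently_small (\<lambda>n. measure M (pre n B))"
      "0 < measure M W" "\<exists>\<^sub>F n in sequentially. measure M W \<le> measure M (pre n B)"
      by (metis oscillating_set)
    then have a
      unfolding a_def by (intro li_yorke_chaotic_if_oscillating assms)
    moreover have g
    proof -
      have "semi_irregular (ol_norm M \<phi> h) (comp_op M \<tau>) (ae_class M (indicator B :: 'a \<Rightarrow> 'b))"
        unfolding indicator_eq_scaleR[where 'k = 'b] using B by (rule indicator_scaleR_semi_irregular) simp
      moreover have "ae_class M (indicator B :: 'a \<Rightarrow> 'k) \<in> L"
        unfolding L indicator_eq_scaleR[where 'k = 'k]
          in_ol_space_iff[OF indicator_scaleR_measurable[OF B(1)]]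
        using indicator_scaleR_iterate_in_ol_functions[OF B(1), of _ 0] by (simp add: comp_def)
      ultimately show ?thesis
        unfolding g_def by (intro bexI[OF _ B(1)] conjI)
    qed
    ultimately show "a \<and> g" ..
  qed
  ultimately have "(a \<longleftrightarrow> b) \<and> (a \<longleftrightarrow> c) \<and> (a \<longleftrightarrow> d) \<and> (a \<longleftrightarrow> e) \<and> (a \<longleftrightarrow> f) \<and> (a \<longleftrightarrow> g)"
    by blast
  then show ?thesis
    unfolding Let_def a_def b_def c_def d_def e_def f_def g_def .
qed

end
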